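(* Let $0<\alpha<1<\beta$, $a\in(0,1)$, $p\in P_{\alpha,\beta}$ and $\lambda\in\mathbb{R}$. If $e\in V(I)$ satisfies $$\int_I e''v''\,dx=\lambda\int_I p\,ev\,dx\qquad \forall v\in V(I),$$ then $e$ solves $$ \begin{cases} e''''(x)=\lambda \,p(x)\, e(x) \\ e(\pm\pi)=e''(\pm \pi)=0\\ e(\pm a\pi)=0 \end{cases} $$ with the differential equation holding a.e. in $I$. Furthermore, denoting by $e_-$, $e_0$, $e_+$ the restrictions of $e$ to $\overline I_-$, $\overline I_0$, $\overline I_+$ respectively, it holds $$e\in C^2(\overline I),\qquad e_-\in C^3(\overline I_-), \qquad e_0\in C^3(\overline I_0),\qquad e_+\in C^3(\overline I_+).$$
   Context: $I=(-\pi,\pi)$, $I_-:=(-\pi,-a\pi)$, $I_0:=(-a\pi,a\pi)$, $I_+:=(a\pi,\pi)$. For $0<\alpha<1<\beta$, $$P_{\alpha, \beta}:=\Big\{p\in L^\infty(I):\ \int_I p\,dx=2\pi,\ \alpha\leq p\leq\beta \text{ and } p(x)=p(-x) \text{ a.e. in } I\Big\}.$$ $V(I):=\{u\in H^2(I)\cap H^1_0(I): u(\pm a\pi)=0\}$ (elements of $V(I)$ are identified with their $C^1(\overline I)$ representatives). *)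

theory Defs
  imports "HOL-Analysis.Analysis"
begin

definition II :: "real set" where "II = {-pi<..<pi}"
definition I_minus :: "real \<Rightarrow> real set" where "I_minus a = {-pi<..<-a*pi}"
definition I_zero :: "real \<Rightarrow> real set" where "I_zero a = {-a*pi<..<a*pi}"
definition I_plus :: "real \<Rightarrow> real set" where "I_plus a = {a*pi<..<pi}"

text \<open>Functions on a subset of the line are represented by total functions on the reals;
  only their values on that subset are relevant.\<close>

definition L2_on :: "real set \<Rightarrow> (real \<Rightarrow> real) set" where
  "L2_on U = {f \<in> borel_measurable (lebesgue_on U). integrable (lebesgue_on U) (\<lambda>x. (f x)\<^sup>2)}"

definition Linf_on :: "real set \<Rightarrow> (real \<Rightarrow> real) set" where
  "Linf_on U = {f \<in> borel_measurable (lebesgue_on U). \<exists>C. AE x in lebesgue_on U. \<bar>f x\<bar> \<le> C}"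

definition L1_loc_on :: "real set \<Rightarrow> (real \<Rightarrow> real) set" where
  "L1_loc_on U = {f. \<forall>K. compact K \<and> K \<subseteq> U \<longrightarrow> integrable (lebesgue_on K) f}"

text \<open>Test functions: the space \<open>C\<^sub>c\<^sup>\<infinity>(U)\<close>, with elements extended by zero to the whole line.\<close>

definition test_functions :: "real set \<Rightarrow> (real \<Rightarrow> real) set" where
  "test_functions U = {\<phi>. (\<forall>k x. (deriv ^^ k) \<phi> differentiable (at x)) \<and>
      compact (closure {x. \<phi> x \<noteq> 0}) \<and> closure {x. \<phi> x \<noteq> 0} \<subseteq> U}"

definition has_weak_deriv :: "real set \<Rightarrow> nat \<Rightarrow> (real \<Rightarrow> real) \<Rightarrow> (real \<Rightarrow> real) \<Rightarrow> bool" where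
  "has_weak_deriv U k u w \<longleftrightarrow> u \<in> L1_loc_on U \<and> w \<in> L1_loc_on U \<and>
    (\<forall>\<phi>\<in>test_functions U.
       (LINT x|lebesgue_on U. u x * (deriv ^^ k) \<phi> x)
         = (-1) ^ k * (LINT x|lebesgue_on U. w x * \<phi> x))"

text \<open>The weak derivative is determined only up to null sets, so an arbitrary representative is
  chosen. It is used below only under integrals.\<close>

definition weak_deriv :: "real set \<Rightarrow> nat \<Rightarrow> (real \<Rightarrow> real) \<Rightarrow> real \<Rightarrow> real" where
  "weak_deriv U k u = (SOME w. has_weak_deriv U k u w)"

definition sobolev_H :: "nat \<Rightarrow> real set \<Rightarrow> (real \<Rightarrow> real) set" where
  "sobolev_H m U = {u \<in> L2_on U. \<forall>k\<in>{1..m}. \<exists>w\<in>L2_on U. has_weak_deriv U k u w}"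

definition H1_norm :: "real set \<Rightarrow> (real \<Rightarrow> real) \<Rightarrow> real" where
  "H1_norm U u = sqrt ((LINT x|lebesgue_on U. (u x)\<^sup>2)
     + (LINT x|lebesgue_on U. (weak_deriv U 1 u x)\<^sup>2))"

definition sobolev_H10 :: "real set \<Rightarrow> (real \<Rightarrow> real) set" where
  "sobolev_H10 U = {u \<in> sobolev_H 1 U.
     \<forall>\<epsilon>>0. \<exists>\<phi>\<in>test_functions U. H1_norm U (\<lambda>x. u x - \<phi> x) < \<epsilon>}"

text \<open>Iterated derivatives relative to a set \<open>S\<close>, hence one-sided at the end points when \<open>S\<close> is a
  compact interval. For \<open>S\<close> a nondegenerate compact interval, \<open>C_on k S\<close> is the space of functions
  whose derivatives up to order \<open>k\<close> are continuous up to the boundary.\<close>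

definition deriv_within :: "real set \<Rightarrow> nat \<Rightarrow> (real \<Rightarrow> real) \<Rightarrow> real \<Rightarrow> real" where
  "deriv_within S k f = ((\<lambda>g x. vector_derivative g (at x within S)) ^^ k) f"

definition C_on :: "nat \<Rightarrow> real set \<Rightarrow> (real \<Rightarrow> real) set" where
  "C_on k S = {f. (\<forall>j<k. deriv_within S j f differentiable_on S) \<and>
     continuous_on S (deriv_within S k f)}"

definition P_class :: "real \<Rightarrow> real \<Rightarrow> (real \<Rightarrow> real) set" where
  "P_class \<alpha> \<beta> = {p \<in> Linf_on II. (LINT x|lebesgue_on II. p x) = 2 * pi \<and>
     (AE x in lebesgue_on II. \<alpha> \<le> p x \<and> p x \<le> \<beta>) \<and>
     (AE x in lebesgue_on II. p x = p (- x))}"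

text \<open>Membership in \<open>C_on 1 (closure II)\<close> selects the continuously differentiable representative
  of the Sobolev class, which gives the point conditions their meaning.\<close>

definition V_space :: "real \<Rightarrow> (real \<Rightarrow> real) set" where
  "V_space a = {u \<in> sobolev_H 2 II \<inter> sobolev_H10 II.
     u \<in> C_on 1 (closure II) \<and> u (a * pi) = 0 \<and> u (- a * pi) = 0}"

text \<open>The third derivative of a solution may jump at \<open>\<plusminus>a\<pi>\<close>, so the distributional fourth derivative
  on \<open>II\<close> need not be a function. Validity of the equation almost everywhere
  is therefore expressed by: the weak fourth derivative on \<open>II\<close> minus
  these two points is the right-hand side, and the classical
  fourth derivative exists and equals the right-hand side at almost every point of \<open>II\<close>.\<close>

definition solves_ode_ae :: "real \<Rightarrow> real \<Rightarrow> (real \<Rightarrow> real) \<Rightarrow> (real \<Rightarrow> real) \<Rightarrow> bool" where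
  "solves_ode_ae a lam p e \<longleftrightarrow>
     has_weak_deriv (I_minus a \<union> I_zero a \<union> I_plus a) 4 e (\<lambda>x. lam * p x * e x) \<and>
     (AE x in lebesgue_on II. (deriv ^^ 3) e differentiable (at x) \<and>
        (deriv ^^ 4) e x = lam * p x * e x)"

end

theory Submission
  imports Defs
begin

text \<open>Write \<open>w\<close> for the weak second derivative of \<open>e\<close>, put \<open>f = \<lambda> p e\<close> and \<open>b = a \<pi>\<close>. The weak equation says
\<open>\<integral> w v'' = \<integral> f v\<close> for all admissible \<open>v\<close>. Integrate \<open>f\<close> twice and subtract a linear function so
that the result \<open>G\<close> vanishes at \<open>\<plusminus>\<pi>\<close>; two integrations by parts give \<open>\<integral> f v = \<integral> G v''\<close>, hence \<open>w - G\<close> is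
orthogonal to \<open>v''\<close> for all these \<open>v\<close>.

The two constraints \<open>v (\<plusminus>b) = 0\<close> are constraints on \<open>v''\<close>: for \<open>v\<close> vanishing at \<open>\<plusminus>\<pi>\<close> one has
\<open>v b = \<integral> k\<^sub>b v''\<close>, where \<open>k\<^sub>b\<close> is the Green function of the second derivative with Dirichlet
conditions, a continuous function which is affine on both sides of \<open>b\<close>. An arbitrary polynomial
vanishing at \<open>\<plusminus>\<pi>\<close> becomes admissible after subtracting multiples of two fixed polynomials, and
every polynomial is the second derivative of a polynomial vanishing at \<open>\<plusminus>\<pi>\<close>. So there are
constants with \<open>w - G - c\<^sub>1 k\<^sub>b - c\<^sub>2 k\<^bsub>-b\<^esub>\<close> orthogonal to all polynomials, which makes it zero almost
everywhere (\<open>weak_equation_representation\<close>).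

Thus \<open>w\<close> has a continuous representative \<open>W\<close>, which vanishes at \<open>\<plusminus>\<pi>\<close> and equals, on each of the
three closed pieces, the double integral of \<open>f\<close> plus an affine function. The assertions are read
off from this formula. The du Bois-Reymond lemma (\<open>weak_second_deriv_imp_classical\<close>) turns \<open>W\<close>
into the classical second derivative of \<open>e\<close> on the closed interval; on each piece \<open>W\<close> is
continuously differentiable with derivative \<open>\<integral> f\<close> plus a constant; and Lebesgue's differentiation
theorem gives the fourth derivative at almost every point. For the distributional equation away
from \<open>\<plusminus>b\<close>, a test function supported there is itself admissible in the weak equation.

What remains is to connect the Sobolev space with calculus. Weak derivatives are unique almost
everywhere (\<open>weak_deriv_unique\<close>), so the arbitrary representative is harmless; smooth functions
vanishing at the end points lie in \<open>H\<^sub>0\<^sup>1\<close> (\<open>smooth_in_sobolev_H10\<close>), which supplies the admissible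
polynomials; and conversely continuously differentiable members of \<open>H\<^sub>0\<^sup>1\<close> vanish at the end points
(\<open>sobolev_H10_vanishes_at_endpoints\<close>), which gives \<open>e (\<plusminus>\<pi>) = 0\<close>.\<close>

section \<open>Smooth functions and test functions\<close>

definition smooth :: "(real \<Rightarrow> real) \<Rightarrow> bool" where
  "smooth f \<longleftrightarrow> (\<forall>k x. (deriv ^^ k) f differentiable at x)"

text \<open>To show that a function is smooth, it suffices to find a class of differentiable functions that
contains it and is closed under differentiation; no formula for the iterated derivatives is needed.\<close>
lemma smooth_coinduct:
  assumes "P f" and step: "\<And>g. P g \<Longrightarrow> (\<forall>x. g differentiable at x) \<and> P (deriv g)"
  shows "smooth f"
proof -
  have "P ((deriv ^^ k) f)" for k
    by (induction k) (use assms in auto)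
  then show ?thesis
    using step by (auto simp: smooth_def)
qed

lemma smooth_DERIV: "smooth f \<Longrightarrow> (f has_real_derivative deriv f x) (at x)"
  unfolding smooth_def
  by (metis DERIV_imp_deriv funpow_0 real_differentiable_def)

lemma smooth_deriv: "smooth f \<Longrightarrow> smooth (deriv f)"
  unfolding smooth_def by (metis funpow_Suc_right comp_apply)

lemma smooth_continuous_on: "smooth f \<Longrightarrow> continuous_on A f"
  by (meson DERIV_isCont continuous_at_imp_continuous_on smooth_DERIV)

text \<open>Products of smooth functions are not closed under differentiation, but finite sums of such
products are, by the product rule.\<close>
inductive sum_of_smooth_products :: "(real \<Rightarrow> real) \<Rightarrow> bool" where
  mult: "smooth f \<Longrightarrow> smooth g \<Longrightarrow> sum_of_smooth_products (\<lambda>x. f x * g x)"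
| add: "sum_of_smooth_products u \<Longrightarrow> sum_of_smooth_products v \<Longrightarrow>
    sum_of_smooth_products (\<lambda>x. u x + v x)"

lemma sum_of_smooth_products_deriv:
  assumes "sum_of_smooth_products u"
  shows "(\<forall>x. u differentiable at x) \<and> sum_of_smooth_products (deriv u)"
  using assms
proof induction
  case (mult f g)
  have d: "((\<lambda>x. f x * g x) has_real_derivative f x * deriv g x + deriv f x * g x) (at x)" for x
    by (rule DERIV_cong[OF DERIV_mult[OF smooth_DERIV smooth_DERIV]]) (use mult in auto)
  then have "deriv (\<lambda>x. f x * g x) = (\<lambda>x. f x * deriv g x + deriv f x * g x)"
    by (intro ext DERIV_imp_deriv)
  then show ?case
    using mult d by (auto simp: real_differentiable_def intro!: sum_of_smooth_products.intros smooth_deriv)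
next
  case (add u v)
  have d: "((\<lambda>x. u x + v x) has_real_derivative deriv u x + deriv v x) (at x)" for x
    using add.IH by (intro DERIV_add) (auto simp: DERIV_deriv_iff_real_differentiable)
  then have "deriv (\<lambda>x. u x + v x) = (\<lambda>x. deriv u x + deriv v x)"
    by (intro ext DERIV_imp_deriv)
  then show ?case
    using add.IH d by (auto simp: real_differentiable_def intro!: sum_of_smooth_products.intros)
qed

lemma smooth_mult:
  assumes "smooth f" "smooth g"
  shows "smooth (\<lambda>x. f x * g x)"
  by (rule smooth_coinduct[of sum_of_smooth_products])
    (use assms sum_of_smooth_products_deriv in \<open>auto intro: sum_of_smooth_products.intros\<close>)

lemma deriv_poly: "deriv (poly p) = poly (pderiv (p :: real poly))"
  by (intro ext DERIV_imp_deriv poly_DERIV)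

lemma smooth_poly: "smooth (poly p)"
  by (rule smooth_coinduct[of "\<lambda>f. \<exists>p. f = poly p"])
    (auto simp: deriv_poly real_differentiable_def intro: poly_DERIV)

lemma smooth_affine:
  assumes "smooth f"
  shows "smooth (\<lambda>x. f (m * x + c))"
proof (rule smooth_coinduct[of "\<lambda>h. \<exists>f k. smooth f \<and> h = (\<lambda>x. k * f (m * x + c))"])
  show "(\<forall>x. h differentiable at x) \<and> (\<exists>f k. smooth f \<and> deriv h = (\<lambda>x. k * f (m * x + c)))"
    if "\<exists>f k. smooth f \<and> h = (\<lambda>x. k * f (m * x + c))" for h
  proof -
    obtain f k where f: "smooth f" "h = (\<lambda>x. k * f (m * x + c))"
      using \<open>\<exists>f k. smooth f \<and> h = (\<lambda>x. k * f (m * x + c))\<close> by blast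
    have "(h has_real_derivative (k * m) * deriv f (m * x + c)) (at x)" for x
      unfolding f by (rule derivative_eq_intros DERIV_chain2[OF smooth_DERIV[OF f(1)]] | simp)+
    moreover from this have "deriv h = (\<lambda>x. (k * m) * deriv f (m * x + c))"
      by (intro ext DERIV_imp_deriv)
    ultimately show ?thesis
      using smooth_deriv[OF f(1)] by (auto simp: real_differentiable_def)
  qed
  show "\<exists>g k. smooth g \<and> (\<lambda>x. f (m * x + c)) = (\<lambda>x. k * g (m * x + c))"
    using assms by (intro exI[of _ f] exI[of _ 1]) auto
qed

text \<open>The functions \<open>p(1/x) e\<^bsup>-1/x\<^esup>\<close>, extended by \<open>0\<close> to \<open>x \<le> 0\<close>. The polynomial factor makes the family
closed under differentiation, which yields smoothness of the classical function \<open>flat 1\<close>.\<close>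
definition flat :: "real poly \<Rightarrow> real \<Rightarrow> real" where
  "flat p x = (if x > 0 then poly p (1 / x) * exp (- (1 / x)) else 0)"

lemma tendsto_poly_times_exp_minus: "((\<lambda>t. poly p t * exp (- t)) \<longlongrightarrow> 0) at_top" for p :: "real poly"
proof -
  have "((\<lambda>t. \<Sum>i\<le>degree p. coeff p i * (t ^ i / exp t)) \<longlongrightarrow> 0) at_top"
    by (intro tendsto_null_sum tendsto_mult_right_zero tendsto_power_div_exp_0)
  then show ?thesis
    by (simp add: poly_altdef sum_divide_distrib exp_minus field_simps)
qed

text \<open>Away from \<open>0\<close> this is the chain rule. At \<open>0\<close> the difference quotient from the right is
\<open>t p(t) e\<^bsup>-t\<^esup>\<close> with \<open>t = 1/h\<close> tending to infinity.\<close>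
lemma DERIV_flat: "(flat p has_real_derivative flat ([:0, 0, 1:] * (p - pderiv p)) x) (at x)"
proof -
  consider "x < 0" | "x > 0" | "x = 0" by linarith
  then show ?thesis
  proof cases
    case 1
    show ?thesis
      by (rule has_field_derivative_transform_within_open[of "\<lambda>_. 0" _ _ "{..<0}"])
        (use 1 in \<open>auto simp: flat_def\<close>)
  next
    case 2
    show ?thesis
    proof (rule has_field_derivative_transform_within_open[of "\<lambda>x. poly p (1 / x) * exp (- (1 / x))" _ _ "{0<..}"])
      show "((\<lambda>x. poly p (1 / x) * exp (- (1 / x))) has_real_derivative
            flat ([:0, 0, 1:] * (p - pderiv p)) x) (at x)"
        using 2 by (auto intro!: derivative_eq_intros DERIV_chain2[OF poly_DERIV]
            simp: flat_def field_simps power2_eq_square)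
    qed (use 2 in \<open>auto simp: flat_def\<close>)
  next
    case 3
    have "((\<lambda>h. flat p h / h) \<longlongrightarrow> 0) (at_left 0)"
      by (rule tendsto_eventually) (auto simp: flat_def eventually_at_filter)
    moreover have "((\<lambda>h. poly ([:0, 1:] * p) (inverse h) * exp (- inverse h)) \<longlongrightarrow> 0) (at_right 0)"
      by (rule filterlim_compose[OF tendsto_poly_times_exp_minus filterlim_inverse_at_top_right])
    then have "((\<lambda>h. flat p h / h) \<longlongrightarrow> 0) (at_right 0)"
      by (rule Lim_transform_eventually)
        (auto simp: flat_def eventually_at_filter field_simps)
    ultimately have "((\<lambda>h. flat p h / h) \<longlongrightarrow> 0) (at 0)"
      by (rule filterlim_split_at)
    then show ?thesis
      using 3 by (simp add: has_field_derivative_iff flat_def)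
  qed
qed

lemma smooth_flat: "smooth (flat p)"
proof (rule smooth_coinduct[of "\<lambda>f. \<exists>p. f = flat p"])
  fix g assume "\<exists>p. g = flat p"
  then obtain p where g: "g = flat p" by blast
  have "deriv g = flat ([:0, 0, 1:] * (p - pderiv p))"
    unfolding g by (intro ext DERIV_imp_deriv DERIV_flat)
  then show "(\<forall>x. g differentiable at x) \<and> (\<exists>p. deriv g = flat p)"
    using DERIV_flat g by (auto simp: real_differentiable_def)
qed blast

lemma deriv_flat_1: "deriv (flat 1) x = (if x > 0 then exp (- (1 / x)) / x\<^sup>2 else 0)"
  by (simp add: DERIV_imp_deriv[OF DERIV_flat] flat_def power2_eq_square field_simps)

lemma flat_1_bounds: "0 \<le> flat 1 x" "flat 1 x \<le> 1"
  by (auto simp: flat_def)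

lemma flat_1_nonzero_iff: "flat 1 x \<noteq> 0 \<longleftrightarrow> x > 0"
  by (auto simp: flat_def)

lemma flat_tendsto_at_top: "(flat p \<longlongrightarrow> poly p 0) at_top"
proof -
  have "((\<lambda>x. poly p (inverse x) * exp (- inverse x)) \<longlongrightarrow> poly p 0 * exp (- 0)) at_top"
    by (intro tendsto_intros tendsto_inverse_0_at_top filterlim_ident)
  then have "((\<lambda>x. poly p (inverse x) * exp (- inverse x)) \<longlongrightarrow> poly p 0) at_top"
    by simp
  then show ?thesis
    by (rule Lim_transform_eventually)
      (auto simp: flat_def inverse_eq_divide intro!: eventually_mono[OF eventually_gt_at_top[of 0]])
qed

text \<open>A bump supported on \<open>{c..d}\<close>. The parameter \<open>n\<close> steepens both flanks, so that the bumps
tend to the indicator of the open interval as \<open>n\<close> grows while staying between \<open>0\<close> and \<open>1\<close>.\<close>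
definition bump :: "real \<Rightarrow> real \<Rightarrow> real \<Rightarrow> real \<Rightarrow> real" where
  "bump n c d x = flat 1 (n * (x - c)) * flat 1 (n * (d - x))"

lemma bump_bounds: "0 \<le> bump n c d x" "bump n c d x \<le> 1"
  by (auto simp: bump_def flat_1_bounds intro: mult_le_one)

lemma bump_nonzero_iff: "n > 0 \<Longrightarrow> bump n c d x \<noteq> 0 \<longleftrightarrow> c < x \<and> x < d"
  by (auto simp: bump_def flat_1_nonzero_iff zero_less_mult_iff)

lemma smooth_bump: "smooth (bump n c d)"
proof -
  have "smooth (\<lambda>x. flat 1 (n * x + - n * c) * flat 1 (- n * x + n * d))"
    by (intro smooth_mult smooth_affine smooth_flat)
  also have "(\<lambda>x. flat 1 (n * x + - n * c) * flat 1 (- n * x + n * d)) = bump n c d"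
    by (auto simp: bump_def algebra_simps)
  finally show ?thesis .
qed

lemma test_functionsI:
  assumes "smooth \<phi>" "\<And>x. x \<notin> {c..d} \<Longrightarrow> \<phi> x = 0" "{c..d} \<subseteq> U"
  shows "\<phi> \<in> test_functions U"
proof -
  have "closure {x. \<phi> x \<noteq> 0} \<subseteq> {c..d}"
  proof (rule closure_minimal)
    show "{x. \<phi> x \<noteq> 0} \<subseteq> {c..d}"
      using assms(2) by blast
  qed simp
  moreover from this have "compact (closure {x. \<phi> x \<noteq> 0})"
    by (metis closed_closure compact_Icc compact_Int_closed inf.absorb_iff2)
  ultimately show ?thesis
    using assms by (auto simp: test_functions_def smooth_def)
qed

lemma test_functions_smooth: "\<phi> \<in> test_functions U \<Longrightarrow> smooth \<phi>"
  by (simp add: test_functions_def smooth_def)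

lemma bump_test_function:
  assumes "n > 0" "{c..d} \<subseteq> U"
  shows "bump n c d \<in> test_functions U"
proof (rule test_functionsI[of _ c d])
  show "bump n c d x = 0" if "x \<notin> {c..d}" for x
    using bump_nonzero_iff[of n c d x] that assms(1) by auto
qed (use assms smooth_bump in auto)

lemma deriv_test_function:
  assumes "\<phi> \<in> test_functions U"
  shows "deriv \<phi> \<in> test_functions U"
proof -
  let ?K = "closure {x. \<phi> x \<noteq> 0}"
  have K: "compact ?K" "?K \<subseteq> U"
    using assms by (auto simp: test_functions_def)
  have "deriv \<phi> x = 0" if "x \<notin> ?K" for x
  proof (rule DERIV_imp_deriv, rule has_field_derivative_transform_within_open[of "\<lambda>_. 0" _ _ "- ?K"])
    show "0 = \<phi> y" if "y \<in> - ?K" for y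
      using that closure_subset[of "{x. \<phi> x \<noteq> 0}"] by auto
  qed (use that in auto)
  then have "closure {x. deriv \<phi> x \<noteq> 0} \<subseteq> ?K"
    by (intro closure_minimal) auto
  moreover from this have "compact (closure {x. deriv \<phi> x \<noteq> 0})"
    by (metis K(1) closed_closure compact_Int_closed inf.absorb_iff2)
  ultimately show ?thesis
    using K smooth_deriv[OF test_functions_smooth[OF assms]] by (auto simp: test_functions_def smooth_def)
qed

lemma funpow_deriv_test_function:
  "\<phi> \<in> test_functions U \<Longrightarrow> (deriv ^^ k) \<phi> \<in> test_functions U"
  by (induction k) (auto intro: deriv_test_function)

lemma test_function_outside: "\<phi> \<in> test_functions U \<Longrightarrow> x \<notin> U \<Longrightarrow> \<phi> x = 0"
  using closure_subset[of "{x. \<phi> x \<noteq> 0}"] by (auto simp: test_functions_def)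

lemma test_functions_mono: "U \<subseteq> T \<Longrightarrow> test_functions U \<subseteq> test_functions T"
  by (auto simp: test_functions_def)

section \<open>Weak derivatives are unique\<close>
lemma AE_lebesgue_on_iff_negligible:
  assumes "S \<in> sets lebesgue"
  shows "(AE x in lebesgue_on S. P x) \<longleftrightarrow> negligible {x \<in> S. \<not> P x}"
proof -
  have "(AE x in lebesgue_on S. P x) \<longleftrightarrow> (AE x in lebesgue. x \<in> S \<longrightarrow> P x)"
    using assms by (simp add: AE_restrict_space_iff)
  also have "\<dots> \<longleftrightarrow> negligible {x \<in> S. \<not> P x}"
    by (simp add: completion.AE_iff_null_sets negligible_iff_null_sets)
  finally show ?thesis .
qed

lemma integrable_lebesgue_on_iff_absolutely_integrable:
  fixes f :: "real \<Rightarrow> real"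
  assumes "S \<in> sets lebesgue"
  shows "integrable (lebesgue_on S) f \<longleftrightarrow> f absolutely_integrable_on S"
  using assms by (simp add: integrable_restrict_space set_integrable_def)

lemma integrable_Ioo_iff_absolutely_integrable:
  fixes f :: "real \<Rightarrow> real"
  shows "integrable (lebesgue_on {c<..<d}) f \<longleftrightarrow> f absolutely_integrable_on {c..d}"
  using absolutely_integrable_on_open_interval[where f=f and a=c and b=d]
  by (simp add: integrable_lebesgue_on_iff_absolutely_integrable)

lemma LINT_Ioo_eq_integral:
  fixes f :: "real \<Rightarrow> real"
  assumes "f absolutely_integrable_on {c..d}"
  shows "(LINT x|lebesgue_on {c<..<d}. f x) = integral {c..d} f"
  using assms lebesgue_integral_eq_integral[of "{c<..<d}" f]
  by (simp add: integrable_Ioo_iff_absolutely_integrable integral_open_interval_real)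

lemma lebesgue_on_supported_in:
  fixes f :: "real \<Rightarrow> real"
  assumes "K \<subseteq> U" "K \<in> sets lebesgue" "U \<in> sets lebesgue" "\<And>x. x \<in> U - K \<Longrightarrow> f x = 0"
  shows "integrable (lebesgue_on U) f \<longleftrightarrow> integrable (lebesgue_on K) f"
    and "(LINT x|lebesgue_on U. f x) = (LINT x|lebesgue_on K. f x)"
proof -
  have eq: "(\<lambda>x. if x \<in> U then f x else 0) = (\<lambda>x. if x \<in> K then f x else 0)"
    using assms by fastforce
  show "integrable (lebesgue_on U) f \<longleftrightarrow> integrable (lebesgue_on K) f"
    using Lebesgue_Measure.integrable_restrict_UNIV[OF assms(2), where f=f] Lebesgue_Measure.integrable_restrict_UNIV[OF assms(3), where f=f]
    by (simp add: eq)
  show "(LINT x|lebesgue_on U. f x) = (LINT x|lebesgue_on K. f x)"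
    using Lebesgue_Measure.integral_restrict_UNIV[OF assms(2), where f=f] Lebesgue_Measure.integral_restrict_UNIV[OF assms(3), where f=f]
    by (simp add: eq)
qed

lemma continuous_times_absolutely_integrable:
  fixes g w :: "real \<Rightarrow> real"
  assumes "continuous_on {c..d} g" "w absolutely_integrable_on {c..d}"
  shows "(\<lambda>x. g x * w x) absolutely_integrable_on {c..d}"
proof (rule absolutely_integrable_bounded_measurable_product_real)
  show "g \<in> borel_measurable (lebesgue_on {c..d})"
    using assms(1) by (intro continuous_imp_measurable_on_sets_lebesgue) auto
  show "bounded (g ` {c..d})"
    using assms(1) compact_continuous_image compact_imp_bounded by blast
qed (use assms in auto)

lemma continuous_in_L1_loc: "continuous_on U f \<Longrightarrow> f \<in> L1_loc_on U"
proof -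
  assume f: "continuous_on U f"
  have "integrable (lebesgue_on K) f" if K: "compact K" "K \<subseteq> U" for K
  proof -
    have c: "continuous_on K f" using f K continuous_on_subset by blast
    obtain B where B: "\<And>x. x \<in> K \<Longrightarrow> \<bar>f x\<bar> \<le> B"
      using compact_imp_bounded[OF compact_continuous_image[OF c K(1)]]
      by (auto simp: bounded_iff)
    have Kl: "K \<in> lmeasurable" using K lmeasurable_compact by blast
    show ?thesis
    proof (rule measurable_bounded_by_integrable_imp_lebesgue_integrable[where g="\<lambda>_. B"])
      show "f \<in> borel_measurable (lebesgue_on K)"
        using c Kl by (intro continuous_imp_measurable_on_sets_lebesgue) auto
      show "integrable (lebesgue_on K) (\<lambda>_. B)"
        using finite_measure.integrable_const[OF finite_measure_lebesgue_on[OF Kl]] .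
    qed (use B Kl in auto)
  qed
  then show ?thesis by (simp add: L1_loc_on_def)
qed

lemma L1_loc_times_test_function_integrable:
  assumes w: "w \<in> L1_loc_on U" and \<phi>: "\<phi> \<in> test_functions U" and U: "open U"
  shows "integrable (lebesgue_on U) (\<lambda>x. w x * \<phi> x)"
proof -
  let ?K = "closure {x. \<phi> x \<noteq> 0}"
  have K: "compact ?K" "?K \<subseteq> U"
    using \<phi> by (auto simp: test_functions_def)
  have K': "?K \<in> sets lebesgue"
    using K(1) lmeasurable_compact by blast
  have c: "continuous_on ?K \<phi>"
    using \<phi> by (intro smooth_continuous_on test_functions_smooth)
  have "(\<lambda>x. \<phi> x * w x) absolutely_integrable_on ?K"
  proof (rule absolutely_integrable_bounded_measurable_product_real)
    show "\<phi> \<in> borel_measurable (lebesgue_on ?K)"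
      using c K' by (intro continuous_imp_measurable_on_sets_lebesgue) auto
    show "bounded (\<phi> ` ?K)"
      using c K compact_continuous_image compact_imp_bounded by blast
    have "integrable (lebesgue_on ?K) w"
      using w K unfolding L1_loc_on_def by blast
    then show "w absolutely_integrable_on ?K"
      using integrable_lebesgue_on_iff_absolutely_integrable[OF K'] by blast
  qed fact
  then have "integrable (lebesgue_on ?K) (\<lambda>x. w x * \<phi> x)"
    using K' by (simp add: integrable_lebesgue_on_iff_absolutely_integrable mult.commute)
  moreover have "w x * \<phi> x = 0" if "x \<in> U - ?K" for x
    using that closure_subset[of "{x. \<phi> x \<noteq> 0}"] by auto
  ultimately show ?thesis
    using lebesgue_on_supported_in(1)[OF K(2) K'] U by simp
qed

lemma bump_tendsto_indicator: "(\<lambda>n. bump (real (Suc n)) c d x) \<longlonglongrightarrow> indicat_real {c<..<d} x"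
proof (cases "c < x \<and> x < d")
  case True
  have lim: "(\<lambda>n. flat 1 (real (Suc n) * u)) \<longlonglongrightarrow> 1" if "u > 0" for u
  proof -
    have "filterlim (\<lambda>n. real (Suc n) * u) at_top sequentially"
      by (rule filterlim_at_top_mult_tendsto_pos[OF tendsto_const that
            filterlim_compose[OF filterlim_real_sequentially filterlim_Suc]])
    from filterlim_compose[OF flat_tendsto_at_top[of 1] this] show ?thesis
      by simp
  qed
  show ?thesis
    using tendsto_mult[OF lim[of "x - c"] lim[of "d - x"]] True by (simp add: bump_def)
next
  case False
  then have "bump (real (Suc n)) c d x = 0" for n
    using bump_nonzero_iff[of "real (Suc n)" c d x] by force
  then show ?thesis
    using False by simp
qed

text \<open>Bumps on \<open>{s..t}\<close> are test functions which converge boundedly to the indicator of the open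
interval, so dominated convergence passes from test functions to intervals.\<close>
lemma weakly_zero_imp_integral_zero:
  assumes w: "w \<in> L1_loc_on U" and U: "open U"
    and zero: "\<And>\<phi>. \<phi> \<in> test_functions U \<Longrightarrow> (LINT x|lebesgue_on U. w x * \<phi> x) = 0"
    and st: "{s..t} \<subseteq> U"
  shows "integral {s..t} w = 0"
proof -
  have int: "integrable (lebesgue_on {s..t}) w"
    using w st by (auto simp: L1_loc_on_def)
  have sets: "{s<..<t} \<in> sets (lebesgue_on {s..t})"
    by (auto simp: sets_restrict_space intro!: image_eqI[of _ _ "{s<..<t}"])
  have "(LINT x|lebesgue_on {s..t}. w x * bump (real (Suc n)) s t x) = 0" for n
  proof -
    have "w x * bump (real (Suc n)) s t x = 0" if "x \<in> U - {s..t}" for x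
      using that bump_nonzero_iff[of "real (Suc n)" s t x] by auto
    then show ?thesis
      using lebesgue_on_supported_in(2)[of "{s..t}" U "\<lambda>x. w x * bump (real (Suc n)) s t x"] st U
        zero[OF bump_test_function[OF _ st, of "real (Suc n)"]] by simp
  qed
  moreover have "(\<lambda>n. LINT x|lebesgue_on {s..t}. w x * bump (real (Suc n)) s t x)
      \<longlonglongrightarrow> (LINT x|lebesgue_on {s..t}. w x * indicat_real {s<..<t} x)"
  proof (rule integral_dominated_convergence[where w="\<lambda>x. \<bar>w x\<bar>"])
    show "(\<lambda>x. w x * indicat_real {s<..<t} x) \<in> borel_measurable (lebesgue_on {s..t})"
      using int sets by (intro borel_measurable_times borel_measurable_integrable borel_measurable_indicator)
    show "(\<lambda>x. w x * bump (real (Suc n)) s t x) \<in> borel_measurable (lebesgue_on {s..t})" for n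
      using int by (intro borel_measurable_times borel_measurable_integrable[OF int]
          continuous_imp_measurable_on_sets_lebesgue smooth_continuous_on smooth_bump) auto
    show "AE x in lebesgue_on {s..t}. norm (w x * bump (real (Suc n)) s t x) \<le> \<bar>w x\<bar>" for n
      using bump_bounds by (intro AE_I2) (simp add: abs_mult mult_left_le)
    show "AE x in lebesgue_on {s..t}. (\<lambda>n. w x * bump (real (Suc n)) s t x) \<longlonglongrightarrow> w x * indicat_real {s<..<t} x"
      by (intro AE_I2 tendsto_mult_left bump_tendsto_indicator)
  qed (use int in auto)
  ultimately have "(LINT x|lebesgue_on {s..t}. w x * indicat_real {s<..<t} x) = 0"
    by (simp add: LIMSEQ_const_iff)
  moreover have "integrable (lebesgue_on {s..t}) (\<lambda>x. w x * indicat_real {s<..<t} x)"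
    using integrable_mult_indicator[OF sets int] by (simp add: mult.commute)
  ultimately have "integral {s..t} (\<lambda>x. w x * indicat_real {s<..<t} x) = 0"
    by (simp add: lebesgue_integral_eq_integral)
  moreover have "integral {s..t} (\<lambda>x. w x * indicat_real {s<..<t} x) = integral {s..t} w"
    by (rule integral_spike[of "{s, t}"]) (auto simp: indicator_def)
  ultimately show ?thesis by simp
qed

text \<open>Almost every value of an integrable function is a limit of its averages over short intervals, and
here all these averages are \<open>0\<close>.\<close>
lemma zero_integrals_imp_negligible_support:
  fixes w :: "real \<Rightarrow> real"
  assumes int: "w integrable_on {s..t}" and zero: "\<And>u v. {u..v} \<subseteq> {s..t} \<Longrightarrow> integral {u..v} w = 0"
  shows "negligible {x \<in> {s..t}. w x \<noteq> 0}"
proof -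
  define g where "g x = (if x \<in> {s..t} then w x else 0)" for x
  have cut: "cbox u v \<inter> {s..t} = {max u s..min v t}" for u v by auto
  have gi: "g integrable_on cbox u v" for u v
  proof -
    have "w integrable_on {max u s..min v t}"
      using int by (rule integrable_on_subinterval) auto
    then show ?thesis
      using Henstock_Kurzweil_Integration.integrable_restrict_Int[where f=w and S="{s..t}" and T="cbox u v"]
      unfolding g_def by (simp add: Int_commute flip: cut)
  qed
  have g0: "integral (cbox u v) g = 0" for u v
    using Henstock_Kurzweil_Integration.integral_restrict_Int[where f=w and S="{s..t}" and T="cbox u v"] zero
    unfolding g_def by (simp add: cut Int_commute)
  obtain N where N: "negligible N" and lim: "\<And>x e. \<lbrakk>x \<notin> N; 0 < e\<rbrakk> \<Longrightarrow>
      \<exists>d>0. \<forall>h. 0 < h \<and> h < d \<longrightarrow> norm (integral (cbox x (x + h *\<^sub>R One)) g /\<^sub>R h ^ DIM(real) - g x) < e"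
    by (rule integrable_ccontinuous_explicit[OF gi]) (rule that)
  have "g x = 0" if x: "x \<notin> N" for x
  proof (rule ccontr)
    assume "g x \<noteq> 0"
    then obtain d where "d > 0" and d: "\<And>h. 0 < h \<Longrightarrow> h < d \<Longrightarrow>
        norm (integral (cbox x (x + h *\<^sub>R One)) g /\<^sub>R h ^ DIM(real) - g x) < \<bar>g x\<bar>"
      using lim[OF x, of "\<bar>g x\<bar>"] by auto
    then have "norm (integral (cbox x (x + (d / 2) *\<^sub>R One)) g /\<^sub>R (d / 2) ^ DIM(real) - g x) < \<bar>g x\<bar>"
      by (intro d) auto
    then show False
      by (simp only: g0) simp
  qed
  then have "{x \<in> {s..t}. w x \<noteq> 0} \<subseteq> N"
    unfolding g_def by fastforce
  then show ?thesis
    using N negligible_subset by blast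
qed

text \<open>The fundamental lemma of the calculus of variations. The previous two lemmas apply on a compact
interval around each point of \<open>U\<close>, and negligibility is a local property.\<close>
lemma weakly_zero_imp_AE_zero:
  assumes w: "w \<in> L1_loc_on U" and U: "open U"
    and zero: "\<And>\<phi>. \<phi> \<in> test_functions U \<Longrightarrow> (LINT x|lebesgue_on U. w x * \<phi> x) = 0"
  shows "AE x in lebesgue_on U. w x = 0"
proof -
  let ?S = "{x \<in> U. w x \<noteq> 0}"
  have "\<exists>V. openin (top_of_set ?S) V \<and> x \<in> V \<and> negligible V" if x: "x \<in> ?S" for x
  proof -
    obtain e where e: "e > 0" "cball x e \<subseteq> U"
      using U x open_contains_cball by blast
    then have st: "{x - e..x + e} \<subseteq> U"
      by (simp add: cball_eq_atLeastAtMost)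
    have "negligible {y \<in> {x - e..x + e}. w y \<noteq> 0}"
    proof (rule zero_integrals_imp_negligible_support)
      show "w integrable_on {x - e..x + e}"
        using w st integrable_on_lebesgue_on[of "{x - e..x + e}" w] by (simp add: L1_loc_on_def)
      show "integral {u..v} w = 0" if "{u..v} \<subseteq> {x - e..x + e}" for u v
        by (rule weakly_zero_imp_integral_zero[OF w U zero order_trans[OF that st]])
    qed
    then have "negligible (?S \<inter> {x - e<..<x + e})"
      by (rule negligible_subset) auto
    moreover have "openin (top_of_set ?S) (?S \<inter> {x - e<..<x + e})"
      by (simp add: openin_open_Int)
    moreover have "x \<in> ?S \<inter> {x - e<..<x + e}"
      using x e(1) by simp
    ultimately show ?thesis by blast
  qed
  then have "negligible ?S"
    by (intro iffD2[OF locally_negligible_alt] ballI)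
  then show ?thesis
    using U by (simp add: AE_lebesgue_on_iff_negligible)
qed

lemma weak_deriv_unique:
  assumes "has_weak_deriv U k u w" "has_weak_deriv U k u w'" "open U"
  shows "AE x in lebesgue_on U. w x = w' x"
proof -
  have w: "w \<in> L1_loc_on U" "w' \<in> L1_loc_on U"
    using assms by (auto simp: has_weak_deriv_def)
  have "AE x in lebesgue_on U. w x - w' x = 0"
  proof (rule weakly_zero_imp_AE_zero)
    show "(\<lambda>x. w x - w' x) \<in> L1_loc_on U"
      using w by (auto simp: L1_loc_on_def)
    show "(LINT x|lebesgue_on U. (w x - w' x) * \<phi> x) = 0" if \<phi>: "\<phi> \<in> test_functions U" for \<phi>
    proof -
      have "(LINT x|lebesgue_on U. (w x - w' x) * \<phi> x)
          = (LINT x|lebesgue_on U. w x * \<phi> x) - (LINT x|lebesgue_on U. w' x * \<phi> x)"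
        using L1_loc_times_test_function_integrable[OF w(1) \<phi>] L1_loc_times_test_function_integrable[OF w(2) \<phi>] assms(3)
        by (simp add: left_diff_distrib)
      moreover have "(-1) ^ k * (LINT x|lebesgue_on U. w x * \<phi> x) = (-1) ^ k * (LINT x|lebesgue_on U. w' x * \<phi> x)"
        using bspec[OF conjunct2[OF conjunct2[OF assms(1)[unfolded has_weak_deriv_def]]] \<phi>]
          bspec[OF conjunct2[OF conjunct2[OF assms(2)[unfolded has_weak_deriv_def]]] \<phi>]
        by (rule trans[OF sym])
      ultimately show ?thesis by simp
    qed
  qed fact
  then show ?thesis by simp
qed

lemma has_weak_deriv_weak_deriv: "has_weak_deriv U k u w \<Longrightarrow> has_weak_deriv U k u (weak_deriv U k u)"
  unfolding weak_deriv_def by (rule someI[of "has_weak_deriv U k u"])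

lemma weak_deriv_AE_eq:
  "has_weak_deriv U k u w \<Longrightarrow> open U \<Longrightarrow> AE x in lebesgue_on U. weak_deriv U k u x = w x"
  by (rule weak_deriv_unique[OF has_weak_deriv_weak_deriv])

section \<open>Classical derivatives and Sobolev spaces\<close>

text \<open>The weak derivative is an arbitrarily chosen function; this lemma, which rests on completeness of
Lebesgue measure, is what makes it measurable once it agrees almost everywhere with a classical
derivative.\<close>
lemma borel_measurable_lebesgue_on_AE_cong:
  fixes f g :: "real \<Rightarrow> real"
  assumes g: "g \<in> borel_measurable (lebesgue_on S)" and S: "S \<in> sets lebesgue"
    and eq: "AE x in lebesgue_on S. f x = g x"
  shows "f \<in> borel_measurable (lebesgue_on S)"
proof -
  have "(\<lambda>x. if x \<in> S then g x else 0) \<in> borel_measurable lebesgue"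
    using g S by (simp add: borel_measurable_if)
  moreover have "AE x in lebesgue. x \<in> S \<longrightarrow> f x = g x"
    using eq S by (simp add: AE_restrict_space_iff)
  then have "AE x in lebesgue. (if x \<in> S then g x else 0) = (if x \<in> S then f x else 0)"
    by (rule AE_mp) auto
  ultimately have "(\<lambda>x. if x \<in> S then f x else 0) \<in> borel_measurable lebesgue"
    by (rule borel_measurable_AE)
  then show ?thesis
    using S borel_measurable_if by blast
qed

lemma C1_has_weak_deriv:
  fixes u u' :: "real \<Rightarrow> real"
  assumes "c \<le> d" and u: "continuous_on {c..d} u" and u': "continuous_on {c..d} u'"
    and D: "\<And>x. x \<in> {c<..<d} \<Longrightarrow> (u has_real_derivative u' x) (at x)"
  shows "has_weak_deriv {c<..<d} 1 u u'"
proof -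
  have sub: "{c<..<d} \<subseteq> {c..d}" by auto
  have "(LINT x|lebesgue_on {c<..<d}. u x * deriv \<phi> x) = - (LINT x|lebesgue_on {c<..<d}. u' x * \<phi> x)"
    if \<phi>: "\<phi> \<in> test_functions {c<..<d}" for \<phi>
  proof -
    have s: "smooth \<phi>" using \<phi> by (rule test_functions_smooth)
    have z: "\<phi> c = 0" "\<phi> d = 0"
      using \<phi> by (auto intro: test_function_outside)
    have c: "continuous_on {c..d} \<phi>" "continuous_on {c..d} (deriv \<phi>)"
      using s by (auto intro: smooth_continuous_on smooth_deriv)
    have i: "(\<lambda>x. u x * deriv \<phi> x) absolutely_integrable_on {c..d}"
            "(\<lambda>x. u' x * \<phi> x) absolutely_integrable_on {c..d}"
      by (intro absolutely_integrable_continuous_real continuous_on_mult u u' c)+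
    have "((\<lambda>x. u x * deriv \<phi> x + u' x * \<phi> x) has_integral (u d * \<phi> d - u c * \<phi> c)) {c..d}"
    proof (rule fundamental_theorem_of_calculus_interior)
      show "((\<lambda>x. u x * \<phi> x) has_vector_derivative u x * deriv \<phi> x + u' x * \<phi> x) (at x)"
        if "x \<in> {c<..<d}" for x
        using DERIV_mult[OF D[OF that] smooth_DERIV[OF s]]
        by (simp add: has_real_derivative_iff_has_vector_derivative add.commute mult.commute)
    qed (use assms c in \<open>auto intro: continuous_on_mult\<close>)
    then have "integral {c..d} (\<lambda>x. u x * deriv \<phi> x + u' x * \<phi> x) = 0"
      using z by (simp add: integral_unique)
    then show ?thesis
      using i by (simp add: LINT_Ioo_eq_integral absolutely_integrable_on_def integral_add)
  qed
  then show ?thesis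
    using continuous_on_subset[OF u sub] continuous_on_subset[OF u' sub]
    by (simp add: has_weak_deriv_def continuous_in_L1_loc)
qed

lemma has_weak_deriv_2I:
  assumes "has_weak_deriv U 1 u u'" "has_weak_deriv U 1 u' u''"
  shows "has_weak_deriv U 2 u u''"
  using assms deriv_test_function by (auto simp: has_weak_deriv_def numeral_2_eq_2)

lemma smooth_has_weak_deriv:
  assumes "c \<le> d" "smooth u"
  shows "has_weak_deriv {c<..<d} 1 u (deriv u)" "has_weak_deriv {c<..<d} 2 u (deriv (deriv u))"
proof -
  have *: "has_weak_deriv {c<..<d} 1 v (deriv v)" if "smooth v" for v
    using assms(1) that by (intro C1_has_weak_deriv) (auto intro: smooth_continuous_on smooth_deriv smooth_DERIV)
  show "has_weak_deriv {c<..<d} 1 u (deriv u)" "has_weak_deriv {c<..<d} 2 u (deriv (deriv u))"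
    by (fact *[OF assms(2)], rule has_weak_deriv_2I[OF *[OF assms(2)] *[OF smooth_deriv[OF assms(2)]]])
qed

lemma continuous_in_L2_on:
  assumes "continuous_on {c..d} u"
  shows "u \<in> L2_on {c<..<d}"
proof -
  have "u \<in> borel_measurable (lebesgue_on {c<..<d})"
    by (intro continuous_imp_measurable_on_sets_lebesgue continuous_on_subset[OF assms]) auto
  moreover have "(\<lambda>x. (u x)\<^sup>2) absolutely_integrable_on {c..d}"
    using assms by (intro absolutely_integrable_continuous_real continuous_intros)
  ultimately show ?thesis
    by (simp add: L2_on_def integrable_Ioo_iff_absolutely_integrable)
qed

lemma smooth_in_sobolev_H:
  assumes "c \<le> d" "smooth u" "m \<le> 2"
  shows "u \<in> sobolev_H m {c<..<d}"
proof -
  have "\<exists>w\<in>L2_on {c<..<d}. has_weak_deriv {c<..<d} k u w" if "k \<in> {1..m}" for k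
  proof -
    have "k = 1 \<or> k = 2" using that assms(3) by auto
    then show ?thesis
      using smooth_has_weak_deriv[OF assms(1,2)] assms(2)
      by (metis continuous_in_L2_on smooth_continuous_on smooth_deriv)
  qed
  then show ?thesis
    using assms(2) by (simp add: sobolev_H_def continuous_in_L2_on smooth_continuous_on)
qed

lemma H1_norm_C1:
  fixes u u' :: "real \<Rightarrow> real"
  assumes "c \<le> d" and u: "continuous_on {c..d} u" and u': "continuous_on {c..d} u'"
    and D: "\<And>x. x \<in> {c<..<d} \<Longrightarrow> (u has_real_derivative u' x) (at x)"
  shows "H1_norm {c<..<d} u = sqrt (integral {c..d} (\<lambda>x. (u x)\<^sup>2 + (u' x)\<^sup>2))"
proof -
  have sq: "(\<lambda>x. (u x)\<^sup>2) absolutely_integrable_on {c..d}" "(\<lambda>x. (u' x)\<^sup>2) absolutely_integrable_on {c..d}"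
    using u u' by (auto intro!: absolutely_integrable_continuous_real continuous_intros)
  have AE: "AE x in lebesgue_on {c<..<d}. weak_deriv {c<..<d} 1 u x = u' x"
    by (rule weak_deriv_AE_eq[OF C1_has_weak_deriv[OF assms]]) auto
  have m: "u' \<in> borel_measurable (lebesgue_on {c<..<d})"
    using continuous_in_L2_on[OF u'] by (simp add: L2_on_def)
  have m': "weak_deriv {c<..<d} 1 u \<in> borel_measurable (lebesgue_on {c<..<d})"
    by (rule borel_measurable_lebesgue_on_AE_cong[OF m _ AE]) simp
  have "(LINT x|lebesgue_on {c<..<d}. (weak_deriv {c<..<d} 1 u x)\<^sup>2) = (LINT x|lebesgue_on {c<..<d}. (u' x)\<^sup>2)"
    by (rule integral_cong_AE) (use m m' AE in \<open>auto intro!: borel_measurable_power elim: AE_mp\<close>)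
  then show ?thesis
    using sq by (simp add: H1_norm_def LINT_Ioo_eq_integral absolutely_integrable_on_def integral_add)
qed

text \<open>The functions \<open>D j\<close> are the candidates for the iterated one-sided derivatives. On a nondegenerate
interval derivatives within the interval are unique, so the candidates are the derivatives there;
outside the interval the two may differ.\<close>
lemma deriv_within_Icc:
  fixes D :: "nat \<Rightarrow> real \<Rightarrow> real"
  assumes "c < d" and "\<And>x. x \<in> {c..d} \<Longrightarrow> f x = D 0 x"
    and D: "\<And>j x. j < k \<Longrightarrow> x \<in> {c..d} \<Longrightarrow> (D j has_real_derivative D (Suc j) x) (at x within {c..d})"
    and "j \<le> k" "x \<in> {c..d}"
  shows "deriv_within {c..d} j f x = D j x"
  using assms(4,5)
proof (induction j arbitrary: x)
  case 0
  then show ?case by (simp add: deriv_within_def assms(2))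
next
  case (Suc j)
  have "(D j has_vector_derivative D (Suc j) x) (at x within {c..d})"
    using D[of j x] Suc.prems by (simp add: has_real_derivative_iff_has_vector_derivative)
  then have "(deriv_within {c..d} j f has_vector_derivative D (Suc j) x) (at x within {c..d})"
    by (rule has_vector_derivative_transform[rotated 2]) (use Suc in auto)
  then show ?case
    using vector_derivative_within_closed_interval[OF \<open>c < d\<close> Suc.prems(2)]
    by (simp add: deriv_within_def)
qed

lemma C_on_IccI:
  fixes D :: "nat \<Rightarrow> real \<Rightarrow> real"
  assumes "c < d" and "\<And>x. x \<in> {c..d} \<Longrightarrow> f x = D 0 x"
    and D: "\<And>j x. j < k \<Longrightarrow> x \<in> {c..d} \<Longrightarrow> (D j has_real_derivative D (Suc j) x) (at x within {c..d})"
    and cont: "continuous_on {c..d} (D k)"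
  shows "f \<in> C_on k {c..d}"
proof -
  note eq = deriv_within_Icc[of c d f D k, OF assms(1-3)]
  have "deriv_within {c..d} j f differentiable_on {c..d}" if "j < k" for j
  proof -
    have "D j differentiable_on {c..d}"
      using D[OF that] unfolding differentiable_on_def real_differentiable_def by blast
    then show ?thesis
      using eq[of j] that by (auto simp: differentiable_on_def intro: differentiable_transform_within[OF _ zero_less_one])
  qed
  moreover have "continuous_on {c..d} (deriv_within {c..d} k f)"
    by (rule continuous_on_eq[OF cont]) (metis eq order_refl)
  ultimately show ?thesis
    by (simp add: C_on_def)
qed

lemma C_on_1_IccD:
  assumes "c < d" "f \<in> C_on 1 {c..d}"
  obtains f' where "continuous_on {c..d} f" "continuous_on {c..d} f'"
    "\<And>x. x \<in> {c..d} \<Longrightarrow> (f has_real_derivative f' x) (at x within {c..d})"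
proof
  have diff: "f differentiable_on {c..d}" and c: "continuous_on {c..d} (deriv_within {c..d} 1 f)"
    using assms(2) by (auto simp: C_on_def deriv_within_def)
  show "continuous_on {c..d} f"
    using diff by (rule differentiable_imp_continuous_on)
  show "continuous_on {c..d} (deriv_within {c..d} 1 f)" by fact
  show "(f has_real_derivative deriv_within {c..d} 1 f x) (at x within {c..d})" if "x \<in> {c..d}" for x
    using diff that vector_derivative_works[of f "at x within {c..d}"]
    by (simp add: differentiable_on_def deriv_within_def has_real_derivative_iff_has_vector_derivative)
qed

lemma DERIV_within_Icc_interior:
  assumes "(f has_real_derivative y) (at x within {c..d})" "x \<in> {c<..<d}"
  shows "(f has_real_derivative y) (at x)"
  using assms at_within_Icc_at[of c x d] by auto

lemma smooth_C_on_1: "smooth f \<Longrightarrow> c < d \<Longrightarrow> f \<in> C_on 1 {c..d}"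
  by (rule C_on_IccI[of _ _ _ "\<lambda>j. (deriv ^^ j) f"])
    (auto intro: smooth_continuous_on smooth_deriv DERIV_subset[OF smooth_DERIV])

section \<open>Vanishing at the end points and membership in H10\<close>

text \<open>With \<open>y = 1/x\<close> the function is \<open>(y + y\<^sup>2) e\<^bsup>-y\<^esup>\<close>. It bounds the product of the steep slope of a
cutoff function with a function that vanishes at the boundary; see \<open>scaled_deriv_flat_1\<close>.\<close>
lemma flat_cutoff_bounds: "0 \<le> flat [:0, 1, 1:] x" "flat [:0, 1, 1:] x \<le> 3"
proof -
  show "0 \<le> flat [:0, 1, 1:] x" by (auto simp: flat_def)
  have "y + y\<^sup>2 \<le> 3 * exp y" if "y \<ge> 0" for y :: real
  proof -
    have "1 + y + y\<^sup>2 / 2 \<le> exp y"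
      using exp_lower_Taylor_quadratic[OF that] .
    then show ?thesis using that zero_le_power2[of y] by linarith
  qed
  from this[of "1 / x"] show "flat [:0, 1, 1:] x \<le> 3"
    by (auto simp: flat_def exp_minus divide_simps power2_eq_square mult_ac)
qed

text \<open>The slope of \<open>flat 1 (n s - 1)\<close> in \<open>s\<close> is of order \<open>n\<close>, but it is concentrated at distance of order
\<open>1/n\<close> from the boundary point \<open>s = 0\<close>; multiplied by \<open>s\<close> it stays bounded, and it tends to \<open>0\<close> for
fixed \<open>s\<close> by \<open>flat_tendsto_at_top\<close> since the polynomial has no constant term.\<close>
lemma scaled_deriv_flat_1:
  assumes "n > 0"
  shows "n * s * deriv (flat 1) (n * s - 1) = flat [:0, 1, 1:] (n * s - 1)"
proof (cases "n * s - 1 > 0")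
  case True
  then show ?thesis
    by (simp add: deriv_flat_1 flat_def field_simps power2_eq_square)
qed (simp add: deriv_flat_1 flat_def)

lemma smooth_vanishing_at_ends_bound:
  assumes "smooth Q" "Q c = 0" "Q d = 0"
  obtains M where "M \<ge> 0" "\<And>x. x \<in> {c..d} \<Longrightarrow> \<bar>deriv Q x\<bar> \<le> M"
    "\<And>x. x \<in> {c..d} \<Longrightarrow> \<bar>Q x\<bar> \<le> M * (x - c)" "\<And>x. x \<in> {c..d} \<Longrightarrow> \<bar>Q x\<bar> \<le> M * (d - x)"
proof -
  have "bounded (deriv Q ` {c..d})"
    using assms(1) by (intro compact_imp_bounded compact_continuous_image smooth_continuous_on smooth_deriv) auto
  then obtain M where "M > 0" and M: "\<And>x. x \<in> {c..d} \<Longrightarrow> \<bar>deriv Q x\<bar> \<le> M"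
    by (auto simp: bounded_pos)
  have lip: "\<bar>Q x - Q y\<bar> \<le> M * \<bar>x - y\<bar>" if "x \<in> {c..d}" "y \<in> {c..d}" for x y
    using field_differentiable_bound[of "{c..d}" Q "deriv Q" M x y] that M smooth_DERIV[OF assms(1)]
    by (auto simp: has_field_derivative_at_within)
  show thesis
  proof (rule that[of M])
    show "\<bar>Q x\<bar> \<le> M * (x - c)" if "x \<in> {c..d}" for x
      using lip[of x c] that assms by auto
    show "\<bar>Q x\<bar> \<le> M * (d - x)" if "x \<in> {c..d}" for x
      using lip[of x d] that assms by auto
  qed (use \<open>M > 0\<close> M in auto)
qed

text \<open>Multiply \<open>Q\<close> by cutoff functions \<open>\<kappa> n\<close> that vanish within distance \<open>1/n\<close> of the boundary and tend
to \<open>1\<close> inside. The derivative of \<open>\<kappa> n\<close> is unbounded, but it is multiplied by \<open>Q\<close>, which vanishes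
linearly at the end points; so \<open>(\<kappa> n)' Q\<close> is bounded and tends to \<open>0\<close> pointwise, and dominated
convergence applies to the explicit majorant \<open>h n\<close> of the error.\<close>
lemma smooth_H1_approx_by_test_functions:
  assumes "c < d" "smooth Q" "Q c = 0" "Q d = 0" "\<epsilon> > 0"
  obtains \<phi> where "\<phi> \<in> test_functions {c<..<d}"
    "integral {c..d} (\<lambda>x. (Q x - \<phi> x)\<^sup>2 + (deriv Q x - deriv \<phi> x)\<^sup>2) < \<epsilon>"
proof -
  obtain M where M: "M \<ge> 0" "\<And>x. x \<in> {c..d} \<Longrightarrow> \<bar>deriv Q x\<bar> \<le> M"
    "\<And>x. x \<in> {c..d} \<Longrightarrow> \<bar>Q x\<bar> \<le> M * (x - c)" "\<And>x. x \<in> {c..d} \<Longrightarrow> \<bar>Q x\<bar> \<le> M * (d - x)"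
    using smooth_vanishing_at_ends_bound[OF assms(2-4)] by blast
  define l r where "l = (\<lambda>n x. real (Suc n) * (x - c) - 1)" and "r = (\<lambda>n x. real (Suc n) * (d - x) - 1)"
  define \<kappa> where "\<kappa> = (\<lambda>n x. flat 1 (l n x) * flat 1 (r n x))"
  define A where "A = (\<lambda>n x. flat [:0, 1, 1:] (l n x) + flat [:0, 1, 1:] (r n x))"
  define \<phi> where "\<phi> = (\<lambda>n x. \<kappa> n x * Q x)"
  define \<kappa>' where "\<kappa>' = (\<lambda>n x. real (Suc n) * deriv (flat 1) (l n x) * flat 1 (r n x)
      - flat 1 (l n x) * (real (Suc n) * deriv (flat 1) (r n x)))"
  define g where "g = (\<lambda>n x. (Q x - \<phi> n x)\<^sup>2 + (deriv Q x - deriv (\<phi> n) x)\<^sup>2)"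
  define h where "h = (\<lambda>n x. (M * (d - c) * (1 - \<kappa> n x))\<^sup>2 + (M * (1 - \<kappa> n x + A n x))\<^sup>2)"
  have \<kappa>_bump: "\<kappa> n = bump (real (Suc n)) (c + 1 / real (Suc n)) (d - 1 / real (Suc n))" for n
  proof
    fix x
    have "real (Suc n) * (x - (c + 1 / real (Suc n))) = l n x"
      "real (Suc n) * (d - 1 / real (Suc n) - x) = r n x"
      unfolding l_def r_def by (simp_all only: right_diff_distrib distrib_left) simp_all
    then show "\<kappa> n x = bump (real (Suc n)) (c + 1 / real (Suc n)) (d - 1 / real (Suc n)) x"
      by (simp only: \<kappa>_def bump_def)
  qed
  have \<kappa>_bounds: "0 \<le> \<kappa> n x" "\<kappa> n x \<le> 1" for n x
    by (simp_all add: \<kappa>_bump bump_bounds)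
  have \<phi>_smooth: "smooth (\<phi> n)" for n
    unfolding \<phi>_def \<kappa>_bump by (intro smooth_mult smooth_bump assms(2))
  have \<phi>_test: "\<phi> n \<in> test_functions {c<..<d}" for n
  proof (rule test_functionsI[OF \<phi>_smooth])
    show "\<phi> n x = 0" if "x \<notin> {c + 1 / real (Suc n)..d - 1 / real (Suc n)}" for x
      using that bump_nonzero_iff[of "real (Suc n)" "c + 1 / real (Suc n)" "d - 1 / real (Suc n)" x]
      by (auto simp: \<phi>_def \<kappa>_bump)
    show "{c + 1 / real (Suc n)..d - 1 / real (Suc n)} \<subseteq> {c<..<d}"
    proof (intro subsetI)
      fix x assume "x \<in> {c + 1 / real (Suc n)..d - 1 / real (Suc n)}"
      then have "c + 1 / real (Suc n) \<le> x" "x \<le> d - 1 / real (Suc n)" "0 < 1 / real (Suc n)"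
        by (simp_all only: atLeastAtMost_iff of_nat_0_less_iff zero_less_divide_1_iff)
      then have "c < x" "x < d" by linarith+
      then show "x \<in> {c<..<d}" by simp
    qed
  qed
  have "((\<lambda>x. flat 1 (N * (x - c) - 1) * flat 1 (N * (d - x) - 1)) has_real_derivative
      N * deriv (flat 1) (N * (x - c) - 1) * flat 1 (N * (d - x) - 1)
      - flat 1 (N * (x - c) - 1) * (N * deriv (flat 1) (N * (d - x) - 1))) (at x)" for N x
  proof -
    have L: "((\<lambda>x. flat 1 (N * (x - c) - 1)) has_real_derivative deriv (flat 1) (N * (x - c) - 1) * N) (at x)"
      by (rule DERIV_chain2[OF smooth_DERIV[OF smooth_flat]]) (auto intro!: derivative_eq_intros)
    have R: "((\<lambda>x. flat 1 (N * (d - x) - 1)) has_real_derivative deriv (flat 1) (N * (d - x) - 1) * (- N)) (at x)"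
      by (rule DERIV_chain2[OF smooth_DERIV[OF smooth_flat]]) (auto intro!: derivative_eq_intros)
    show ?thesis
      by (rule DERIV_cong[OF DERIV_mult[OF L R]]) (simp add: mult_ac)
  qed
  then have \<kappa>_DERIV: "(\<kappa> n has_real_derivative \<kappa>' n x) (at x)" for n x
    by (simp only: \<kappa>_def \<kappa>'_def l_def r_def)
  have \<phi>_deriv: "deriv (\<phi> n) x = \<kappa>' n x * Q x + deriv Q x * \<kappa> n x" for n x
    unfolding \<phi>_def by (intro DERIV_imp_deriv DERIV_mult \<kappa>_DERIV smooth_DERIV assms(2))
  have f'_nonneg: "0 \<le> deriv (flat 1) t" for t
    by (simp add: deriv_flat_1)
  have \<kappa>'_Q: "\<bar>\<kappa>' n x * Q x\<bar> \<le> M * A n x" if "x \<in> {c..d}" for n x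
  proof -
    let ?n = "real (Suc n)"
    let ?L = "?n * deriv (flat 1) (l n x)" and ?R = "?n * deriv (flat 1) (r n x)"
    have "\<bar>?L * flat 1 (r n x) * Q x\<bar> \<le> ?L * 1 * (M * (x - c))"
      unfolding abs_mult using M(3)[OF that] f'_nonneg flat_1_bounds by (intro mult_mono) auto
    also have "\<dots> = M * flat [:0, 1, 1:] (l n x)"
      using scaled_deriv_flat_1[of ?n "x - c"] by (simp add: l_def mult_ac)
    finally have L: "\<bar>?L * flat 1 (r n x) * Q x\<bar> \<le> M * flat [:0, 1, 1:] (l n x)" .
    have "\<bar>flat 1 (l n x) * ?R * Q x\<bar> \<le> 1 * ?R * (M * (d - x))"
      unfolding abs_mult using M(4)[OF that] f'_nonneg flat_1_bounds by (intro mult_mono) auto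
    also have "\<dots> = M * flat [:0, 1, 1:] (r n x)"
      using scaled_deriv_flat_1[of ?n "d - x"] by (simp add: r_def mult_ac)
    finally have R: "\<bar>flat 1 (l n x) * ?R * Q x\<bar> \<le> M * flat [:0, 1, 1:] (r n x)" .
    have "\<kappa>' n x * Q x = ?L * flat 1 (r n x) * Q x - flat 1 (l n x) * ?R * Q x"
      by (simp add: \<kappa>'_def left_diff_distrib)
    then show ?thesis
      using L R by (simp add: A_def distrib_left)
  qed
  have g_le_h: "g n x \<le> h n x" if x: "x \<in> {c..d}" for n x
  proof -
    have "Q x - \<phi> n x = Q x * (1 - \<kappa> n x)"
      by (simp add: \<phi>_def right_diff_distrib mult.commute)
    then have "\<bar>Q x - \<phi> n x\<bar> = \<bar>Q x\<bar> * (1 - \<kappa> n x)"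
      using \<kappa>_bounds[of n x] by (simp add: abs_mult)
    also have "\<dots> \<le> M * (d - c) * (1 - \<kappa> n x)"
    proof (rule mult_right_mono)
      have "\<bar>Q x\<bar> \<le> M * (x - c)" by (rule M(3)[OF x])
      also have "\<dots> \<le> M * (d - c)" using x M(1) by (intro mult_left_mono) auto
      finally show "\<bar>Q x\<bar> \<le> M * (d - c)" .
    qed (use \<kappa>_bounds in auto)
    finally have 1: "\<bar>Q x - \<phi> n x\<bar> \<le> M * (d - c) * (1 - \<kappa> n x)" .
    have "\<bar>deriv Q x - deriv (\<phi> n) x\<bar> = \<bar>deriv Q x * (1 - \<kappa> n x) - \<kappa>' n x * Q x\<bar>"
      by (simp add: \<phi>_deriv algebra_simps)
    also have "\<dots> \<le> \<bar>deriv Q x * (1 - \<kappa> n x)\<bar> + \<bar>\<kappa>' n x * Q x\<bar>"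
      by (rule abs_triangle_ineq4)
    also have "\<dots> \<le> M * (1 - \<kappa> n x) + M * A n x"
    proof (rule add_mono)
      show "\<bar>deriv Q x * (1 - \<kappa> n x)\<bar> \<le> M * (1 - \<kappa> n x)"
        using \<kappa>_bounds[of n x] M(2)[OF x] by (simp add: abs_mult mult_right_mono)
    qed (rule \<kappa>'_Q[OF x])
    finally have 2: "\<bar>deriv Q x - deriv (\<phi> n) x\<bar> \<le> M * (1 - \<kappa> n x + A n x)"
      by (simp add: distrib_left)
    show ?thesis
      using power_mono[OF 1, of 2] power_mono[OF 2, of 2] by (simp add: g_def h_def)
  qed
  have A_bounds: "0 \<le> A n x" "A n x \<le> 6" for n x
    using flat_cutoff_bounds[of "l n x"] flat_cutoff_bounds[of "r n x"] by (auto simp: A_def)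
  have h_lim: "(\<lambda>n. h n x) \<longlonglongrightarrow> 0" if "x \<in> {c<..<d}" for x
  proof -
    have lim: "filterlim (\<lambda>n. real (Suc n) * s - 1) at_top sequentially" if "s > 0" for s
    proof -
      have "filterlim (\<lambda>n. real (Suc n) * s) at_top sequentially"
        by (rule filterlim_at_top_mult_tendsto_pos[OF tendsto_const that
              filterlim_compose[OF filterlim_real_sequentially filterlim_Suc]])
      from filterlim_tendsto_add_at_top[OF tendsto_const[of "- 1"] this] show ?thesis
        by simp
    qed
    have lr: "filterlim (\<lambda>n. l n x) at_top sequentially" "filterlim (\<lambda>n. r n x) at_top sequentially"
      unfolding l_def r_def by (rule lim, use that in simp)+
    have fl: "(\<lambda>n. flat p (l n x)) \<longlonglongrightarrow> poly p 0" "(\<lambda>n. flat p (r n x)) \<longlonglongrightarrow> poly p 0" for p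
      by (rule filterlim_compose[OF flat_tendsto_at_top] lr)+
    have "(\<lambda>n. \<kappa> n x) \<longlonglongrightarrow> 1 * 1" "(\<lambda>n. A n x) \<longlonglongrightarrow> 0 + 0"
      unfolding \<kappa>_def A_def using fl[of 1] fl[of "[:0, 1, 1:]"] by (auto intro!: tendsto_eq_intros)
    then have "(\<lambda>n. h n x) \<longlonglongrightarrow> (M * (d - c) * (1 - 1 * 1))\<^sup>2 + (M * (1 - 1 * 1 + (0 + 0)))\<^sup>2"
      unfolding h_def by (intro tendsto_intros)
    then show ?thesis by simp
  qed
  have cont: "continuous_on S (\<kappa> n)" "continuous_on S (A n)" for S n
  proof -
    show "continuous_on S (\<kappa> n)" unfolding \<kappa>_bump by (intro smooth_continuous_on smooth_bump)
    have *: "continuous_on S (\<lambda>x. flat p (k x))" if "continuous_on S k" for p k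
      by (rule continuous_on_compose2[OF smooth_continuous_on[OF smooth_flat, where A=UNIV] that]) simp
    have "continuous_on S (\<lambda>x. flat [:0, 1, 1:] (l n x))"
      unfolding l_def by (rule *) (intro continuous_intros)
    moreover have "continuous_on S (\<lambda>x. flat [:0, 1, 1:] (r n x))"
      unfolding r_def by (rule *) (intro continuous_intros)
    ultimately show "continuous_on S (A n)" unfolding A_def by (rule continuous_on_add)
  qed
  have h_cont: "continuous_on S (h n)" for S n
    unfolding h_def by (intro continuous_intros cont)
  have g_cont: "continuous_on S (g n)" for S n
    unfolding g_def by (intro continuous_on_add continuous_on_power continuous_on_diff)
      (intro smooth_continuous_on smooth_deriv \<phi>_smooth assms(2))+
  let ?I = "lebesgue_on {c<..<d}"
  have fin: "finite_measure ?I" by (rule finite_measure_lebesgue_on) auto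
  have "(\<lambda>n. LINT x|?I. h n x) \<longlonglongrightarrow> (LINT x|?I. 0)"
  proof (rule integral_dominated_convergence[where w="\<lambda>_. (M * (d - c))\<^sup>2 + (M * 7)\<^sup>2"])
    show "h n \<in> borel_measurable ?I" for n
      by (intro continuous_imp_measurable_on_sets_lebesgue h_cont) auto
    show "integrable ?I (\<lambda>_. (M * (d - c))\<^sup>2 + (M * 7)\<^sup>2)"
      using finite_measure.integrable_const[OF fin] .
    show "AE x in ?I. (\<lambda>n. h n x) \<longlonglongrightarrow> 0"
      using h_lim by (intro AE_I2) auto
    show "AE x in ?I. norm (h n x) \<le> (M * (d - c))\<^sup>2 + (M * 7)\<^sup>2" for n
    proof (rule AE_I2)
      fix x
      have "M * (d - c) * (1 - \<kappa> n x) \<le> M * (d - c)" "0 \<le> M * (d - c) * (1 - \<kappa> n x)"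
        using \<kappa>_bounds[of n x] M(1) \<open>c < d\<close> by (auto intro!: mult_left_le)
      moreover have "M * (1 - \<kappa> n x + A n x) \<le> M * 7" "0 \<le> M * (1 - \<kappa> n x + A n x)"
        using \<kappa>_bounds[of n x] A_bounds[of n x] M(1) by (auto intro!: mult_left_mono)
      ultimately have "h n x \<le> (M * (d - c))\<^sup>2 + (M * 7)\<^sup>2"
        unfolding h_def by (intro add_mono power_mono)
      moreover have "norm (h n x) = h n x" by (simp add: h_def)
      ultimately show "norm (h n x) \<le> (M * (d - c))\<^sup>2 + (M * 7)\<^sup>2" by simp
    qed
  qed simp
  then have "(\<lambda>n. LINT x|?I. h n x) \<longlonglongrightarrow> 0" by simp
  from eventually_happens'[OF sequentially_bot order_tendstoD(2)[OF this \<open>\<epsilon> > 0\<close>]]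
  obtain n where n: "(LINT x|?I. h n x) < \<epsilon>" by blast
  have "integral {c..d} (g n) = (LINT x|?I. g n x)"
    by (rule LINT_Ioo_eq_integral[symmetric]) (intro absolutely_integrable_continuous_real g_cont)
  also have "\<dots> \<le> (LINT x|?I. h n x)"
  proof (rule integral_mono)
    show "integrable ?I (g n)" "integrable ?I (h n)"
      unfolding integrable_Ioo_iff_absolutely_integrable
      by (intro absolutely_integrable_continuous_real g_cont h_cont)+
  qed (use g_le_h in simp)
  finally show thesis
    using n that[OF \<phi>_test[of n]] by (simp add: g_def)
qed

lemma smooth_in_sobolev_H10:
  assumes "c < d" "smooth Q" "Q c = 0" "Q d = 0"
  shows "Q \<in> sobolev_H10 {c<..<d}"
proof -
  have "\<exists>\<phi>\<in>test_functions {c<..<d}. H1_norm {c<..<d} (\<lambda>x. Q x - \<phi> x) < \<epsilon>" if "\<epsilon> > 0" for \<epsilon>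
  proof -
    have "\<epsilon>\<^sup>2 > 0" using that by simp
    then obtain \<phi> where \<phi>: "\<phi> \<in> test_functions {c<..<d}"
      "integral {c..d} (\<lambda>x. (Q x - \<phi> x)\<^sup>2 + (deriv Q x - deriv \<phi> x)\<^sup>2) < \<epsilon>\<^sup>2"
      by (rule smooth_H1_approx_by_test_functions[OF assms])
    have s: "smooth \<phi>" using \<phi>(1) by (rule test_functions_smooth)
    have "H1_norm {c<..<d} (\<lambda>x. Q x - \<phi> x)
        = sqrt (integral {c..d} (\<lambda>x. (Q x - \<phi> x)\<^sup>2 + (deriv Q x - deriv \<phi> x)\<^sup>2))"
    proof (rule H1_norm_C1)
      show "((\<lambda>x. Q x - \<phi> x) has_real_derivative deriv Q x - deriv \<phi> x) (at x)" for x
        by (intro DERIV_diff smooth_DERIV assms(2) s)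
    qed (use assms s in \<open>auto intro!: continuous_on_diff intro: smooth_continuous_on smooth_deriv\<close>)
    also have "\<dots> < sqrt (\<epsilon>\<^sup>2)"
      using \<phi>(2) by (rule real_sqrt_less_mono)
    finally show ?thesis using \<phi>(1) that by auto
  qed
  then show ?thesis
    using smooth_in_sobolev_H[of c d Q 1] assms by (auto simp: sobolev_H10_def)
qed

lemma closure_II: "closure II = {-pi..pi}"
  by (simp add: II_def)

lemma smooth_in_V_space:
  assumes "smooth v" "v pi = 0" "v (- pi) = 0" "v (a * pi) = 0" "v (- a * pi) = 0"
  shows "v \<in> V_space a"
  using assms smooth_in_sobolev_H[of "-pi" pi v 2] smooth_in_sobolev_H10[of "-pi" pi v]
    smooth_C_on_1[of v "-pi" pi]
  by (simp add: V_space_def closure_II II_def)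

text \<open>Replaces the Cauchy-Schwarz inequality: it bounds an \<open>L\<^sup>1\<close> norm by \<open>\<epsilon>\<close> when the \<open>L\<^sup>2\<close> norm is below
\<open>\<epsilon>\<close>, up to a constant depending on the length of the interval.\<close>
lemma abs_le_young: "\<epsilon> > 0 \<Longrightarrow> \<bar>t\<bar> \<le> (\<epsilon> + t\<^sup>2 * (1 / \<epsilon>)) / 2" for t :: real
proof -
  assume "\<epsilon> > 0"
  have "0 \<le> (\<epsilon> - \<bar>t\<bar>)\<^sup>2" by simp
  then have "2 * \<epsilon> * \<bar>t\<bar> \<le> \<epsilon>\<^sup>2 + t\<^sup>2" by (simp add: power2_diff)
  then show ?thesis using \<open>\<epsilon> > 0\<close> by (simp add: field_simps power2_eq_square)
qed

text \<open>A trace inequality. With \<open>z\<close> the other end point, \<open>(x - z) g(x)\<close> vanishes at \<open>z\<close> and equals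
\<open>\<plusminus>(d - c) g(y)\<close> at \<open>y\<close>, so this value is the integral of \<open>g + (x - z) g'\<close>.\<close>
lemma endpoint_bound:
  fixes g g' :: "real \<Rightarrow> real"
  assumes "c < d" and g: "continuous_on {c..d} g" and g': "continuous_on {c..d} g'"
    and D: "\<And>x. x \<in> {c<..<d} \<Longrightarrow> (g has_real_derivative g' x) (at x)"
    and y: "y = c \<or> y = d" and \<epsilon>: "\<epsilon> > 0"
    and small: "integral {c..d} (\<lambda>x. (g x)\<^sup>2 + (g' x)\<^sup>2) < \<epsilon>\<^sup>2"
  shows "(d - c) * \<bar>g y\<bar> \<le> (1 + (d - c)) * (d - c + 1) * \<epsilon>"
proof -
  define z where "z = c + d - y"
  have z: "z = c \<and> y = d \<or> z = d \<and> y = c" using y by (auto simp: z_def)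
  have "((\<lambda>x. g x + (x - z) * g' x) has_integral ((d - z) * g d - (c - z) * g c)) {c..d}"
  proof (rule fundamental_theorem_of_calculus_interior)
    show "((\<lambda>x. (x - z) * g x) has_vector_derivative g x + (x - z) * g' x) (at x)"
      if "x \<in> {c<..<d}" for x
      unfolding has_real_derivative_iff_has_vector_derivative[symmetric]
      by (rule derivative_eq_intros D[OF that] refl | simp add: algebra_simps)+
  qed (use assms(1) g in \<open>auto intro!: continuous_intros\<close>)
  then have "(d - c) * \<bar>g y\<bar> = \<bar>integral {c..d} (\<lambda>x. g x + (x - z) * g' x)\<bar>"
    using z \<open>c < d\<close> by (auto simp: integral_unique abs_mult)
  also have "\<dots> \<le> integral {c..d} (\<lambda>x. (1 + (d - c)) * (\<epsilon> + ((g x)\<^sup>2 + (g' x)\<^sup>2) * (1 / \<epsilon>)))"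
    unfolding real_norm_def[symmetric]
  proof (rule integral_norm_bound_integral)
    have half: "(\<epsilon> + s) / 2 + (\<epsilon> + t) / 2 \<le> \<epsilon> + (s + t)" if "0 \<le> s" "0 \<le> t" for s t
      using that by (simp add: field_simps)
    show "norm (g x + (x - z) * g' x) \<le> (1 + (d - c)) * (\<epsilon> + ((g x)\<^sup>2 + (g' x)\<^sup>2) * (1 / \<epsilon>))"
      if x: "x \<in> {c..d}" for x
    proof -
      have "\<bar>g x + (x - z) * g' x\<bar> \<le> \<bar>g x\<bar> + \<bar>x - z\<bar> * \<bar>g' x\<bar>"
        by (metis abs_mult abs_triangle_ineq)
      also have "\<dots> \<le> (1 + (d - c)) * \<bar>g x\<bar> + (1 + (d - c)) * \<bar>g' x\<bar>"
      proof (rule add_mono)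
        show "\<bar>g x\<bar> \<le> (1 + (d - c)) * \<bar>g x\<bar>"
          using mult_right_mono[of 1 "1 + (d - c)" "\<bar>g x\<bar>"] \<open>c < d\<close> by simp
        show "\<bar>x - z\<bar> * \<bar>g' x\<bar> \<le> (1 + (d - c)) * \<bar>g' x\<bar>"
          using x z by (intro mult_right_mono) auto
      qed
      also have "\<dots> \<le> (1 + (d - c)) * ((\<epsilon> + (g x)\<^sup>2 * (1 / \<epsilon>)) / 2 + (\<epsilon> + (g' x)\<^sup>2 * (1 / \<epsilon>)) / 2)"
        unfolding distrib_left[symmetric] using abs_le_young[OF \<epsilon>] \<open>c < d\<close>
        by (intro mult_left_mono add_mono) auto
      also have "\<dots> \<le> (1 + (d - c)) * (\<epsilon> + ((g x)\<^sup>2 + (g' x)\<^sup>2) * (1 / \<epsilon>))"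
      proof (rule mult_left_mono)
        have "0 \<le> (g x)\<^sup>2 * (1 / \<epsilon>)" "0 \<le> (g' x)\<^sup>2 * (1 / \<epsilon>)" using \<epsilon> by simp_all
        then show "(\<epsilon> + (g x)\<^sup>2 * (1 / \<epsilon>)) / 2 + (\<epsilon> + (g' x)\<^sup>2 * (1 / \<epsilon>)) / 2
            \<le> \<epsilon> + ((g x)\<^sup>2 + (g' x)\<^sup>2) * (1 / \<epsilon>)"
          unfolding distrib_right by (rule half)
      qed (use \<open>c < d\<close> in auto)
      finally show ?thesis by simp
    qed
  qed (intro integrable_continuous_real continuous_intros g g')+
  also have "\<dots> = (1 + (d - c)) * ((d - c) * \<epsilon> + integral {c..d} (\<lambda>x. (g x)\<^sup>2 + (g' x)\<^sup>2) * (1 / \<epsilon>))"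
  proof -
    have "(\<lambda>x. (g x)\<^sup>2 + (g' x)\<^sup>2) integrable_on {c..d}"
      by (intro integrable_continuous_real continuous_intros g g')
    note H = has_integral_mult_right[OF has_integral_add[OF has_integral_const_real[of \<epsilon> c d]
        has_integral_mult_left[OF integrable_integral[OF this], of "1 / \<epsilon>"]], of "1 + (d - c)"]
    show ?thesis using integral_unique[OF H] \<open>c < d\<close> by simp
  qed
  also have "\<dots> \<le> (1 + (d - c)) * ((d - c) * \<epsilon> + \<epsilon>)"
  proof (intro mult_left_mono add_left_mono)
    show "integral {c..d} (\<lambda>x. (g x)\<^sup>2 + (g' x)\<^sup>2) * (1 / \<epsilon>) \<le> \<epsilon>"
      using small \<epsilon> by (simp add: field_simps power2_eq_square)
  qed (use \<open>c < d\<close> in auto)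
  finally show ?thesis by (simp add: algebra_simps)
qed

text \<open>Test functions vanish at the end points, and the trace inequality carries this over to the
\<open>H\<^sup>1\<close> limit. The choice of \<open>\<epsilon>\<close> makes the inequality bound \<open>\<bar>u y\<bar>\<close> by half of itself.\<close>
lemma sobolev_H10_vanishes_at_endpoints:
  fixes u u' :: "real \<Rightarrow> real"
  assumes "c < d" "u \<in> sobolev_H10 {c<..<d}"
    and u: "continuous_on {c..d} u" and u': "continuous_on {c..d} u'"
    and D: "\<And>x. x \<in> {c<..<d} \<Longrightarrow> (u has_real_derivative u' x) (at x)"
    and y: "y = c \<or> y = d"
  shows "u y = 0"
proof (rule ccontr)
  assume "u y \<noteq> 0"
  define C where "C = (1 + (d - c)) * (d - c + 1)"
  have "C > 0" using \<open>c < d\<close> by (simp add: C_def)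
  \<comment> \<open>Small enough to contradict \<open>(d - c) * \<bar>u y\<bar> \<le> C * \<epsilon>\<close>.\<close>
  define \<epsilon> where "\<epsilon> = (d - c) * \<bar>u y\<bar> / (2 * C)"
  have "\<epsilon> > 0" using \<open>c < d\<close> \<open>C > 0\<close> \<open>u y \<noteq> 0\<close> by (simp add: \<epsilon>_def)
  then obtain \<phi> where \<phi>: "\<phi> \<in> test_functions {c<..<d}" "H1_norm {c<..<d} (\<lambda>x. u x - \<phi> x) < \<epsilon>"
    using assms(2) by (auto simp: sobolev_H10_def)
  have s: "smooth \<phi>" using \<phi>(1) by (rule test_functions_smooth)
  have c: "continuous_on {c..d} \<phi>" "continuous_on {c..d} (deriv \<phi>)"
    using s by (auto intro: smooth_continuous_on smooth_deriv)
  have D': "((\<lambda>x. u x - \<phi> x) has_real_derivative u' x - deriv \<phi> x) (at x)" if "x \<in> {c<..<d}" for x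
    by (intro DERIV_diff D that smooth_DERIV s)
  have cont: "continuous_on {c..d} (\<lambda>x. u x - \<phi> x)" "continuous_on {c..d} (\<lambda>x. u' x - deriv \<phi> x)"
    by (intro continuous_on_diff u u' c)+
  have "sqrt (integral {c..d} (\<lambda>x. (u x - \<phi> x)\<^sup>2 + (u' x - deriv \<phi> x)\<^sup>2)) < \<epsilon>"
    using \<phi>(2) H1_norm_C1[OF _ cont D'] \<open>c < d\<close> by simp
  also have "\<epsilon> = sqrt (\<epsilon>\<^sup>2)"
    using \<open>\<epsilon> > 0\<close> by simp
  finally have "integral {c..d} (\<lambda>x. (u x - \<phi> x)\<^sup>2 + (u' x - deriv \<phi> x)\<^sup>2) < \<epsilon>\<^sup>2"
    by (simp only: real_sqrt_less_iff)
  then have "(d - c) * \<bar>u y - \<phi> y\<bar> \<le> C * \<epsilon>"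
    using endpoint_bound[of c d "\<lambda>x. u x - \<phi> x" "\<lambda>x. u' x - deriv \<phi> x" y \<epsilon>, OF \<open>c < d\<close> cont D' y \<open>\<epsilon> > 0\<close>]
    by (simp only: C_def)
  moreover have "\<phi> y = 0"
    using \<phi>(1) y by (auto intro: test_function_outside)
  ultimately have "(d - c) * \<bar>u y\<bar> \<le> (d - c) * \<bar>u y\<bar> / 2"
    using \<open>C > 0\<close> by (simp add: \<epsilon>_def)
  moreover have "(d - c) * \<bar>u y\<bar> > 0"
    using \<open>c < d\<close> \<open>u y \<noteq> 0\<close> by simp
  ultimately show False by linarith
qed

section \<open>Indefinite integrals and the Green function\<close>
lemma quadratic_increment_imp_constant:
  fixes H :: "real \<Rightarrow> real"
  assumes "\<And>x y. c \<le> x \<Longrightarrow> x \<le> y \<Longrightarrow> y \<le> d \<Longrightarrow> \<bar>H y - H x\<bar> \<le> K * (y - x)\<^sup>2" and "c \<le> d"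
  shows "H d = H c"
proof -
  have "(H has_real_derivative 0) (at x within {c..d})" if x: "x \<in> {c..d}" for x
  proof -
    have "((\<lambda>y. (H y - H x) / (y - x)) \<longlongrightarrow> 0) (at x within {c..d})"
    proof (rule Lim_null_comparison)
      show "\<forall>\<^sub>F y in at x within {c..d}. norm ((H y - H x) / (y - x)) \<le> K * \<bar>y - x\<bar>"
        unfolding eventually_at_filter
      proof (intro always_eventually allI impI)
        fix y assume y: "y \<noteq> x" "y \<in> {c..d}"
        have "\<bar>H y - H x\<bar> \<le> K * (y - x)\<^sup>2"
          using assms(1)[of x y] assms(1)[of y x] x y
          by (cases "x \<le> y") (auto simp: abs_minus_commute power2_commute)
        also have "\<dots> = K * \<bar>y - x\<bar> * \<bar>y - x\<bar>"
          by (simp add: power2_eq_square)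
        finally show "norm ((H y - H x) / (y - x)) \<le> K * \<bar>y - x\<bar>"
          using y by (simp add: abs_divide pos_divide_le_eq)
      qed
      show "((\<lambda>y. K * \<bar>y - x\<bar>) \<longlongrightarrow> 0) (at x within {c..d})"
        by (auto intro!: tendsto_eq_intros)
    qed
    then show ?thesis by (simp add: has_field_derivative_iff)
  qed
  then obtain k where "\<And>x. x \<in> {c..d} \<Longrightarrow> H x = k"
    using has_field_derivative_zero_constant[of "{c..d}" H] by auto
  then show ?thesis using \<open>c \<le> d\<close> by auto
qed

lemma integral_bound_Icc:
  fixes f :: "real \<Rightarrow> real"
  assumes "f integrable_on {x..y}" "\<And>t. t \<in> {x..y} \<Longrightarrow> \<bar>f t\<bar> \<le> B" "x \<le> y" "0 \<le> B"
  shows "\<bar>integral {x..y} f\<bar> \<le> B * (y - x)"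
  using has_integral_bound_real[of B "{}" f "integral {x..y} f" x y] assms
  by (simp add: integrable_integral)

text \<open>The indefinite integral of \<open>f\<close> need not be differentiable everywhere, so the product rule is not
available. Instead, the difference \<open>H\<close> of the two sides, as a function of the upper limit, changes by
at most a constant times the square of the increment: the first-order terms cancel, and what is
left are integrals of products of two factors, one of which is Lipschitz and vanishes at an end of
the short interval.\<close>
lemma integration_by_parts_bounded:
  fixes f v :: "real \<Rightarrow> real"
  assumes "c \<le> d" and f: "f absolutely_integrable_on {c..d}" and B: "\<And>x. \<bar>f x\<bar> \<le> B" and v: "smooth v"
  shows "integral {c..d} (\<lambda>x. f x * v x)
    = integral {c..d} f * v d - integral {c..d} (\<lambda>x. integral {c..x} f * deriv v x)"
proof -
  define \<Phi> where "\<Phi> x = integral {c..x} f" for x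
  define H where "H x = \<Phi> x * v x - integral {c..x} (\<lambda>t. f t * v t) - integral {c..x} (\<lambda>t. \<Phi> t * deriv v t)" for x
  have B0: "0 \<le> B" using B[of 0] by linarith
  obtain L where "L > 0" and L: "\<And>x. x \<in> {c..d} \<Longrightarrow> \<bar>deriv v x\<bar> \<le> L"
  proof -
    have "bounded (deriv v ` {c..d})"
      using v by (intro compact_imp_bounded compact_continuous_image smooth_continuous_on smooth_deriv) auto
    then show thesis using that by (auto simp: bounded_pos)
  qed
  have lip: "\<bar>v x - v y\<bar> \<le> L * \<bar>x - y\<bar>" if "x \<in> {c..d}" "y \<in> {c..d}" for x y
    using field_differentiable_bound[of "{c..d}" v "deriv v" L x y] that L smooth_DERIV[OF v]
    by (auto simp: has_field_derivative_at_within)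
  have fi: "f integrable_on {c..d}" using f absolutely_integrable_on_def by blast
  have cont_v: "continuous_on S v" "continuous_on S (deriv v)" for S
    using v by (auto intro: smooth_continuous_on smooth_deriv)
  have fvi: "(\<lambda>t. f t * v t) integrable_on {c..d}"
    using continuous_times_absolutely_integrable[OF cont_v(1) f]
    by (simp add: absolutely_integrable_on_def mult.commute)
  have \<Phi>_cont: "continuous_on {c..d} \<Phi>"
    unfolding \<Phi>_def by (rule indefinite_integral_continuous_1[OF fi])
  have \<Phi>vi: "(\<lambda>t. \<Phi> t * deriv v t) integrable_on {c..d}"
    by (intro integrable_continuous_real continuous_on_mult \<Phi>_cont cont_v)
  have incr: "\<bar>H y - H x\<bar> \<le> (2 * B * L) * (y - x)\<^sup>2" if xy: "c \<le> x" "x \<le> y" "y \<le> d" for x y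
  proof -
    have sub: "g integrable_on {x..y}" if "g integrable_on {c..d}" for g :: "real \<Rightarrow> real"
      using that by (rule integrable_on_subinterval) (use xy in auto)
    have split: "integral {c..y} g = integral {c..x} g + integral {x..y} g" if "g integrable_on {c..d}" for g :: "real \<Rightarrow> real"
    proof -
      have "g integrable_on {c..y}" using that by (rule integrable_on_subinterval) (use xy in auto)
      then show ?thesis
        using Henstock_Kurzweil_Integration.integral_combine[of c x y g] xy by simp
    qed
    have \<Phi>_incr: "\<bar>\<Phi> x - \<Phi> t\<bar> \<le> B * (t - x)" if t: "t \<in> {x..y}" for t
    proof -
      have "f integrable_on {x..t}" using fi by (rule integrable_on_subinterval) (use xy t in auto)
      then have "\<bar>integral {x..t} f\<bar> \<le> B * (t - x)"
        using B B0 t by (intro integral_bound_Icc) auto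
      moreover have "f integrable_on {c..t}" using fi by (rule integrable_on_subinterval) (use xy t in auto)
      then have "\<Phi> t = \<Phi> x + integral {x..t} f"
        using Henstock_Kurzweil_Integration.integral_combine[of c x t f] xy t by (simp add: \<Phi>_def)
      ultimately show ?thesis by simp
    qed
    have i1: "(\<lambda>t. f t * (v y - v t)) integrable_on {x..y}"
      unfolding right_diff_distrib by (intro integrable_diff integrable_on_mult_left sub fi fvi)
    have i2: "(\<lambda>t. (\<Phi> x - \<Phi> t) * deriv v t) integrable_on {x..y}"
      unfolding left_diff_distrib
      by (intro integrable_diff integrable_on_mult_right sub \<Phi>vi integrable_continuous_real cont_v)
    have "integral {x..y} (\<lambda>t. f t * (v y - v t)) = (\<Phi> y - \<Phi> x) * v y - integral {x..y} (\<lambda>t. f t * v t)"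
      using sub[OF fi] sub[OF fvi] split[OF fi]
      by (simp add: right_diff_distrib integral_diff integrable_on_mult_left \<Phi>_def)
    moreover have "integral {x..y} (deriv v) = v y - v x"
      using xy smooth_DERIV[OF v]
      by (intro integral_unique fundamental_theorem_of_calculus)
        (auto simp: has_real_derivative_iff_has_vector_derivative[symmetric] has_field_derivative_at_within)
    then have "integral {x..y} (\<lambda>t. (\<Phi> x - \<Phi> t) * deriv v t)
        = \<Phi> x * (v y - v x) - integral {x..y} (\<lambda>t. \<Phi> t * deriv v t)"
      using sub[OF \<Phi>vi] integrable_continuous_real[OF cont_v(2)[of "{x..y}"]]
      by (simp add: left_diff_distrib integral_diff integrable_on_mult_right)
    ultimately have "H y - H x = integral {x..y} (\<lambda>t. f t * (v y - v t))
        + integral {x..y} (\<lambda>t. (\<Phi> x - \<Phi> t) * deriv v t)"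
      using split[OF fvi] split[OF \<Phi>vi] by (simp add: H_def algebra_simps)
    moreover have "\<bar>integral {x..y} (\<lambda>t. f t * (v y - v t))\<bar> \<le> B * (L * (y - x)) * (y - x)"
    proof (rule integral_bound_Icc[OF i1])
      show "\<bar>f t * (v y - v t)\<bar> \<le> B * (L * (y - x))" if t: "t \<in> {x..y}" for t
      proof -
        have "\<bar>v y - v t\<bar> \<le> L * \<bar>y - t\<bar>" using t xy by (intro lip) auto
        also have "\<dots> \<le> L * (y - x)" using t \<open>L > 0\<close> by (intro mult_left_mono) auto
        finally show ?thesis unfolding abs_mult using B B0 by (intro mult_mono) auto
      qed
    qed (use xy B0 \<open>L > 0\<close> in auto)
    moreover have "\<bar>integral {x..y} (\<lambda>t. (\<Phi> x - \<Phi> t) * deriv v t)\<bar> \<le> B * (y - x) * L * (y - x)"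
    proof (rule integral_bound_Icc[OF i2])
      show "\<bar>(\<Phi> x - \<Phi> t) * deriv v t\<bar> \<le> B * (y - x) * L" if t: "t \<in> {x..y}" for t
      proof -
        have "\<bar>\<Phi> x - \<Phi> t\<bar> \<le> B * (t - x)" by (rule \<Phi>_incr[OF t])
        also have "\<dots> \<le> B * (y - x)" using t B0 by (intro mult_left_mono) auto
        finally show ?thesis unfolding abs_mult using L t xy B0 by (intro mult_mono) auto
      qed
    qed (use xy B0 \<open>L > 0\<close> in auto)
    ultimately have "\<bar>H y - H x\<bar> \<le> B * (L * (y - x)) * (y - x) + B * (y - x) * L * (y - x)"
      by linarith
    then show ?thesis by (simp add: power2_eq_square algebra_simps)
  qed
  have "H d = H c"
    by (rule quadratic_increment_imp_constant[OF incr \<open>c \<le> d\<close>])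
  then show ?thesis by (simp add: H_def \<Phi>_def)
qed

lemma has_integral_affine_times_second_deriv:
  assumes "s \<le> t" "smooth v"
  shows "((\<lambda>y. (m * y + q) * deriv (deriv v) y) has_integral
    ((m * t + q) * deriv v t - m * v t) - ((m * s + q) * deriv v s - m * v s)) {s..t}"
proof (rule fundamental_theorem_of_calculus[OF \<open>s \<le> t\<close>])
  fix x
  have "((\<lambda>y. (m * y + q) * deriv v y - m * v y) has_real_derivative
      (m * x + q) * deriv (deriv v) x) (at x within {s..t})"
    by (rule has_field_derivative_at_within)
      (rule derivative_eq_intros smooth_DERIV smooth_deriv assms(2) refl | simp)+
  then show "((\<lambda>y. (m * y + q) * deriv v y - m * v y) has_vector_derivative
      (m * x + q) * deriv (deriv v) x) (at x within {s..t})"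
    by (simp add: has_real_derivative_iff_has_vector_derivative)
qed

text \<open>The Green function at \<open>b\<close> of the second derivative on \<open>{-pi..pi}\<close> with Dirichlet conditions: half
of \<open>\<bar>y - b\<bar>\<close> minus the affine function with the same values at \<open>\<plusminus>pi\<close>.\<close>
definition point_kernel :: "real \<Rightarrow> real \<Rightarrow> real" where
  "point_kernel b y = (\<bar>y - b\<bar> - pi + b * y / pi) / 2"

text \<open>The kernel is affine on each side of \<open>b\<close>, with explicit primitive of its product with \<open>v''\<close>; the
boundary terms \<open>A\<close> and \<open>B\<close> of the two sides add up to \<open>v b\<close> because the kernel vanishes at \<open>\<plusminus>pi\<close> and
its slope jumps by \<open>1\<close> at \<open>b\<close>.\<close>
lemma integral_point_kernel:
  assumes b: "- pi \<le> b" "b \<le> pi" and v: "smooth v" "v pi = 0" "v (- pi) = 0"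
  shows "integral {-pi..pi} (\<lambda>y. point_kernel b y * deriv (deriv v) y) = v b"
proof -
  let ?k = "\<lambda>y. point_kernel b y * deriv (deriv v) y"
  define A where "A = ((((b / pi - 1) / 2) * b + (b - pi) / 2) * deriv v b - ((b / pi - 1) / 2) * v b)
      - ((((b / pi - 1) / 2) * (- pi) + (b - pi) / 2) * deriv v (- pi) - ((b / pi - 1) / 2) * v (- pi))"
  define B where "B = ((((b / pi + 1) / 2) * pi + (- b - pi) / 2) * deriv v pi - ((b / pi + 1) / 2) * v pi)
      - ((((b / pi + 1) / 2) * b + (- b - pi) / 2) * deriv v b - ((b / pi + 1) / 2) * v b)"
  have "(?k has_integral A) {-pi..b}"
    unfolding A_def
  proof (rule has_integral_eq[OF _ has_integral_affine_times_second_deriv[OF b(1) v(1)]])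
    show "((b / pi - 1) / 2 * y + (b - pi) / 2) * deriv (deriv v) y = ?k y" if "y \<in> {-pi..b}" for y
      using that by (simp add: point_kernel_def field_simps)
  qed
  moreover have "(?k has_integral B) {b..pi}"
    unfolding B_def
  proof (rule has_integral_eq[OF _ has_integral_affine_times_second_deriv[OF b(2) v(1)]])
    show "((b / pi + 1) / 2 * y + (- b - pi) / 2) * deriv (deriv v) y = ?k y" if "y \<in> {b..pi}" for y
      using that by (simp add: point_kernel_def field_simps)
  qed
  ultimately have "(?k has_integral A + B) {-pi..pi}"
    by (rule has_integral_combine[OF b])
  moreover have "A + B = v b"
    using v by (simp add: A_def B_def field_simps)
  ultimately show ?thesis by (simp add: integral_unique)
qed

lemma continuous_point_kernel: "continuous_on S (point_kernel b)"
  unfolding point_kernel_def by (intro continuous_intros) auto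

lemma point_kernel_endpoints:
  assumes "- pi \<le> b" "b \<le> pi"
  shows "point_kernel b pi = 0" "point_kernel b (- pi) = 0"
  using assms by (auto simp: point_kernel_def)

text \<open>A one-dimensional form of \<open>integrable_ccontinuous_explicit\<close>, with the \<open>\<epsilon>\<close>-\<open>\<delta>\<close> statement turned into
a limit.\<close>
lemma indefinite_integral_right_derivative_off_negligible:
  fixes g :: "real \<Rightarrow> real"
  assumes "\<And>u v. g integrable_on {u..v}"
  obtains N where "negligible N" "\<And>x. x \<notin> N \<Longrightarrow> ((\<lambda>h. integral {x..x + h} g / h) \<longlongrightarrow> g x) (at_right 0)"
proof -
  obtain N where N: "negligible N" and lim: "\<And>x e. \<lbrakk>x \<notin> N; 0 < e\<rbrakk> \<Longrightarrow>
      \<exists>d>0. \<forall>h. 0 < h \<and> h < d \<longrightarrow> norm (integral (cbox x (x + h *\<^sub>R One)) g /\<^sub>R h ^ DIM(real) - g x) < e"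
    by (rule integrable_ccontinuous_explicit[of g]) (use assms in \<open>auto simp: that\<close>)
  have "((\<lambda>h. integral {x..x + h} g / h) \<longlongrightarrow> g x) (at_right 0)" if x: "x \<notin> N" for x
  proof (rule tendstoI)
    fix e :: real assume "e > 0"
    from lim[OF x this] obtain d where "d > 0"
      and d: "\<And>h. 0 < h \<Longrightarrow> h < d \<Longrightarrow> norm (integral (cbox x (x + h *\<^sub>R One)) g /\<^sub>R h ^ DIM(real) - g x) < e"
      by blast
    then show "\<forall>\<^sub>F h in at_right 0. dist (integral {x..x + h} g / h) (g x) < e"
      unfolding eventually_at_right_field
      by (intro exI[of _ d]) (auto simp: dist_norm divide_inverse mult.commute)
  qed
  then show thesis using that N by blast
qed

text \<open>Lebesgue's differentiation theorem on an interval. The right-hand derivative is the preceding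
lemma for \<open>f\<close> extended by zero; the left-hand derivative is the same lemma for the reflected
function.\<close>
lemma AE_has_derivative_indefinite_integral:
  fixes f :: "real \<Rightarrow> real"
  assumes f: "f integrable_on {c..d}"
  shows "AE x in lebesgue_on {c<..<d}. ((\<lambda>y. integral {c..y} f) has_real_derivative f x) (at x)"
proof -
  define g where "g x = (if x \<in> {c..d} then f x else 0)" for x
  have gi: "g integrable_on {u..v}" for u v
  proof -
    have "f integrable_on {max c u..min d v}"
      using f by (rule integrable_on_subinterval) auto
    then have "f integrable_on ({c..d} \<inter> {u..v})"
      by simp
    then show ?thesis
      unfolding g_def by (simp only: Henstock_Kurzweil_Integration.integrable_restrict_Int)
  qed
  have gi': "(\<lambda>x. g (- x)) integrable_on {u..v}" for u v
  proof -
    have "(\<lambda>x. g (- x)) integrable_on {- (- u)..- (- v)}"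
      by (subst Henstock_Kurzweil_Integration.integrable_reflect_real) (rule gi)
    then show ?thesis by simp
  qed
  obtain N where N: "negligible N"
    "\<And>x. x \<notin> N \<Longrightarrow> ((\<lambda>h. integral {x..x + h} g / h) \<longlongrightarrow> g x) (at_right 0)"
    using indefinite_integral_right_derivative_off_negligible[of g, OF gi] by blast
  obtain N' where N': "negligible N'"
    "\<And>x. x \<notin> N' \<Longrightarrow> ((\<lambda>h. integral {x..x + h} (\<lambda>t. g (- t)) / h) \<longlongrightarrow> g (- x)) (at_right 0)"
    using indefinite_integral_right_derivative_off_negligible[of "\<lambda>x. g (- x)", OF gi'] by blast
  have "((\<lambda>y. integral {c..y} f) has_real_derivative f x) (at x)"
    if x: "x \<in> {c<..<d}" "x \<notin> N" "- x \<notin> N'" for x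
  proof -
    have gx: "g x = f x" using x by (simp add: g_def)
    have near: "\<forall>\<^sub>F h in at 0. x + h \<in> {c<..<d}"
    proof -
      have "((\<lambda>h. x + h) \<longlongrightarrow> x + 0) (at 0)" by (intro tendsto_intros)
      then show ?thesis by (rule topological_tendstoD) (use x in auto)
    qed
    have fg: "integral {u..v} f = integral {u..v} g" if "c \<le> u" "v \<le> d" for u v
      by (rule integral_cong) (use that in \<open>auto simp: g_def\<close>)
    have sub: "f integrable_on {u..v}" if "c \<le> u" "v \<le> d" for u v
      using f by (rule integrable_on_subinterval) (use that in auto)
    have right: "((\<lambda>h. (integral {c..x + h} f - integral {c..x} f) / h) \<longlongrightarrow> f x) (at_right 0)"
    proof (rule Lim_transform_eventually)
      show "((\<lambda>h. integral {x..x + h} g / h) \<longlongrightarrow> f x) (at_right 0)"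
        using N(2)[OF x(2)] gx by simp
      have "\<forall>\<^sub>F h in at_right 0. x + h \<in> {c<..<d} \<and> h > 0"
        using near eventually_at_right_less[of "0 :: real"]
        unfolding eventually_at_split by (intro eventually_conj) auto
      then show "\<forall>\<^sub>F h in at_right 0. integral {x..x + h} g / h = (integral {c..x + h} f - integral {c..x} f) / h"
      proof eventually_elim
        case (elim h)
        then have "integral {c..x + h} f = integral {c..x} f + integral {x..x + h} f"
          using Henstock_Kurzweil_Integration.integral_combine[of c x "x + h" f] sub[of c "x + h"] x by auto
        then show ?case using fg[of x "x + h"] elim x by simp
      qed
    qed
    have "((\<lambda>h. (integral {c..x - h} f - integral {c..x} f) / (- h)) \<longlongrightarrow> f x) (at_right 0)"
    proof (rule Lim_transform_eventually)
      show "((\<lambda>h. integral {- x..- x + h} (\<lambda>t. g (- t)) / h) \<longlongrightarrow> f x) (at_right 0)"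
        using N'(2)[OF x(3)] gx by simp
      have "\<forall>\<^sub>F h in at_right 0. x - h \<in> {c<..<d} \<and> h > 0"
      proof -
        have "((\<lambda>h. x - h) \<longlongrightarrow> x - 0) (at_right 0)" by (intro tendsto_intros)
        then have "\<forall>\<^sub>F h in at_right 0. x - h \<in> {c<..<d}"
          by (rule topological_tendstoD) (use x in auto)
        then show ?thesis
          using eventually_at_right_less[of "0 :: real"] by (intro eventually_conj) auto
      qed
      then show "\<forall>\<^sub>F h in at_right 0. integral {- x..- x + h} (\<lambda>t. g (- t)) / h
          = (integral {c..x - h} f - integral {c..x} f) / (- h)"
      proof eventually_elim
        case (elim h)
        have "integral {- x..- (x - h)} (\<lambda>t. g (- t)) = integral {x - h..x} g"
          by (rule Henstock_Kurzweil_Integration.integral_reflect_real)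
        then have "integral {- x..- x + h} (\<lambda>t. g (- t)) = integral {x - h..x} g"
          by simp
        moreover have "integral {c..x} f = integral {c..x - h} f + integral {x - h..x} f"
          using Henstock_Kurzweil_Integration.integral_combine[of c "x - h" x f] sub[of c x] x elim by auto
        ultimately show ?case using fg[of "x - h" x] elim x by (simp add: field_simps)
      qed
    qed
    then have left: "((\<lambda>h. (integral {c..x + h} f - integral {c..x} f) / h) \<longlongrightarrow> f x) (at_left 0)"
      unfolding filterlim_at_left_to_right by simp
    show ?thesis
      using filterlim_split_at[OF left right] by (simp add: DERIV_def)
  qed
  then have "{x \<in> {c<..<d}. \<not> ((\<lambda>y. integral {c..y} f) has_real_derivative f x) (at x)} \<subseteq> N \<union> uminus ` N'"
    by force
  moreover have "negligible (N \<union> uminus ` N')"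
    using N(1) N'(1) by (intro negligible_Un negligible_differentiable_image_negligible differentiable_on_minus differentiable_on_ident) auto
  ultimately have "negligible {x \<in> {c<..<d}. \<not> ((\<lambda>y. integral {c..y} f) has_real_derivative f x) (at x)}"
    by (rule negligible_subset[rotated])
  then show ?thesis
    by (subst AE_lebesgue_on_iff_negligible) simp_all
qed

section \<open>Orthogonality to polynomials and the du Bois-Reymond lemma\<close>
lemma ex_poly_antiderivative: "\<exists>q. pderiv q = p" for p :: "real poly"
proof
  show "pderiv (\<Sum>i\<le>degree p. monom (coeff p i / (i + 1)) (i + 1)) = p"
    by (rule poly_eqI) (auto simp: coeff_pderiv coeff_sum coeff_monom if_distrib coeff_eq_0 cong: if_cong)
qed

lemma ex_poly_second_antiderivative_zero_boundary:
  fixes p :: "real poly"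
  assumes "c < d"
  obtains q where "pderiv (pderiv q) = p" "poly q c = 0" "poly q d = 0"
proof -
  obtain r s where r: "pderiv r = p" "pderiv s = r"
    using ex_poly_antiderivative by metis
  define m where "m = (poly s d - poly s c) / (d - c)"
  define q where "q = s - [:poly s c - m * c, m:]"
  have "pderiv (pderiv q) = p"
    by (simp add: q_def pderiv_diff r pderiv_pCons)
  moreover have "poly q c = 0" by (simp add: q_def)
  moreover have "m * (d - c) = poly s d - poly s c"
    using assms by (simp add: m_def)
  then have "poly q d = 0"
    by (simp add: q_def algebra_simps)
  ultimately show thesis using that by blast
qed

lemma poly_uniform_approximation:
  fixes g :: "real \<Rightarrow> real"
  assumes "continuous_on {c..d} g" "e > 0"
  obtains p where "\<And>x. x \<in> {c..d} \<Longrightarrow> \<bar>g x - poly p x\<bar> < e"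
proof -
  obtain h where h: "real_polynomial_function h" "\<And>x. x \<in> {c..d} \<Longrightarrow> \<bar>g x - h x\<bar> < e"
    using Stone_Weierstrass_real_polynomial_function[of "{c..d}" g e] assms by auto
  obtain a n where "h = (\<lambda>x. \<Sum>i\<le>n. a i * x ^ i)"
    using h(1) real_polynomial_function_iff_sum by auto
  then have "h x = poly (\<Sum>i\<le>n. monom (a i) i) x" for x
    by (simp add: poly_sum poly_monom)
  then show thesis using h(2) that by metis
qed

text \<open>Uniform approximation by polynomials suffices because \<open>h\<close> is integrable.\<close>
lemma orthogonal_to_polys_imp_orthogonal_to_continuous:
  fixes h g :: "real \<Rightarrow> real"
  assumes h: "h absolutely_integrable_on {c..d}"
    and zero: "\<And>p. integral {c..d} (\<lambda>x. h x * poly p x) = 0" and g: "continuous_on {c..d} g"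
  shows "integral {c..d} (\<lambda>x. h x * g x) = 0"
proof -
  define I where "I = integral {c..d} (\<lambda>x. \<bar>h x\<bar>)"
  have absint: "(\<lambda>x. \<bar>h x\<bar>) integrable_on {c..d}"
    using h by (simp add: absolutely_integrable_on_def)
  then have "I \<ge> 0" unfolding I_def by (intro integral_nonneg) auto
  have int: "(\<lambda>x. h x * u x) integrable_on {c..d}" if "continuous_on {c..d} u" for u
    using continuous_times_absolutely_integrable[OF that h]
    by (simp add: absolutely_integrable_on_def mult.commute)
  have "\<bar>integral {c..d} (\<lambda>x. h x * g x)\<bar> \<le> 0 + e" if "e > 0" for e
  proof -
    define \<delta> where "\<delta> = e / (I + 1)"
    have "\<delta> > 0" using that \<open>I \<ge> 0\<close> by (simp add: \<delta>_def)
    then obtain p where p: "\<And>x. x \<in> {c..d} \<Longrightarrow> \<bar>g x - poly p x\<bar> < \<delta>"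
      using poly_uniform_approximation[OF g] by blast
    have pc: "continuous_on {c..d} (poly p)" by (intro continuous_intros)
    have "integral {c..d} (\<lambda>x. h x * g x) = integral {c..d} (\<lambda>x. h x * g x - h x * poly p x)"
      using int[OF g] int[OF pc] zero[of p] by (simp add: integral_diff)
    also have "\<bar>\<dots>\<bar> \<le> integral {c..d} (\<lambda>x. \<bar>h x\<bar> * \<delta>)"
      unfolding real_norm_def[symmetric]
    proof (rule integral_norm_bound_integral)
      show "norm (h x * g x - h x * poly p x) \<le> norm (h x) * \<delta>" if "x \<in> {c..d}" for x
        using p[OF that] by (simp add: abs_mult mult_left_mono flip: right_diff_distrib)
    qed (use int[OF g] int[OF pc] absint in \<open>auto intro: integrable_diff integrable_on_mult_left\<close>)
    also have "\<dots> = I * \<delta>" by (simp add: I_def)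
    also have "\<dots> \<le> e"
      using that \<open>I \<ge> 0\<close> by (simp add: \<delta>_def field_simps)
    finally show ?thesis by simp
  qed
  then have "\<bar>integral {c..d} (\<lambda>x. h x * g x)\<bar> \<le> 0" by (rule field_le_epsilon)
  then show ?thesis by simp
qed

lemma orthogonal_to_polys_imp_AE_zero:
  fixes h :: "real \<Rightarrow> real"
  assumes h: "h absolutely_integrable_on {c..d}"
    and zero: "\<And>p. integral {c..d} (\<lambda>x. h x * poly p x) = 0"
  shows "AE x in lebesgue_on {c<..<d}. h x = 0"
proof (rule weakly_zero_imp_AE_zero)
  show "h \<in> L1_loc_on {c<..<d}"
    unfolding L1_loc_on_def
  proof (intro CollectI allI impI)
    fix K assume K: "compact K \<and> K \<subseteq> {c<..<d}"
    then have "K \<in> sets lebesgue" using lmeasurable_compact by blast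
    moreover have "K \<subseteq> {c..d}" using K by (auto dest: subsetD)
    ultimately show "integrable (lebesgue_on K) h"
      using set_integrable_subset[OF h] by (simp add: integrable_lebesgue_on_iff_absolutely_integrable)
  qed
  show "(LINT x|lebesgue_on {c<..<d}. h x * \<phi> x) = 0" if "\<phi> \<in> test_functions {c<..<d}" for \<phi>
  proof -
    have c: "continuous_on {c..d} \<phi>"
      by (intro smooth_continuous_on test_functions_smooth[OF that])
    show ?thesis
      using continuous_times_absolutely_integrable[OF c h]
        orthogonal_to_polys_imp_orthogonal_to_continuous[OF h zero c]
      by (simp add: LINT_Ioo_eq_integral mult.commute)
  qed
qed simp

lemma continuous_orthogonal_to_polys_imp_zero:
  fixes h :: "real \<Rightarrow> real"
  assumes "c < d" and h: "continuous_on {c..d} h"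
    and zero: "\<And>p. integral {c..d} (\<lambda>x. h x * poly p x) = 0" and x: "x \<in> {c..d}"
  shows "h x = 0"
proof -
  have "integral {c..d} (\<lambda>x. h x * h x) = 0"
    by (rule orthogonal_to_polys_imp_orthogonal_to_continuous[OF absolutely_integrable_continuous_real[OF h] zero h])
  moreover have "(\<lambda>x. h x * h x) integrable_on {c..d}"
    by (intro integrable_continuous_real continuous_on_mult h)
  ultimately have "((\<lambda>x. h x * h x) has_integral 0) (cbox c d)"
    by (simp add: has_integral_integrable_integral)
  from has_integral_0_cbox_imp_0[OF _ _ this, of x] show ?thesis
    using assms by (auto intro: continuous_on_mult)
qed

text \<open>Extends the hypothesis from test functions to all smooth functions vanishing at the end points, by
density in the \<open>H\<^sup>1\<close> norm.\<close>
lemma weakly_constant_orthogonal_to_derivs: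
  fixes h :: "real \<Rightarrow> real"
  assumes "c < d" and h: "continuous_on {c..d} h"
    and zero: "\<And>\<phi>. \<phi> \<in> test_functions {c<..<d} \<Longrightarrow> integral {c..d} (\<lambda>x. h x * deriv \<phi> x) = 0"
    and Q: "smooth Q" "Q c = 0" "Q d = 0"
  shows "integral {c..d} (\<lambda>x. h x * deriv Q x) = 0"
proof -
  obtain B where "B > 0" and B: "\<And>x. x \<in> {c..d} \<Longrightarrow> \<bar>h x\<bar> \<le> B"
    using compact_imp_bounded[OF compact_continuous_image[OF h]] by (auto simp: bounded_pos)
  have "\<bar>integral {c..d} (\<lambda>x. h x * deriv Q x)\<bar> \<le> 0 + e" if "e > 0" for e
  proof -
    define \<epsilon> where "\<epsilon> = e / (B * (d - c + 1))"
    have "\<epsilon> > 0" using that \<open>B > 0\<close> \<open>c < d\<close> by (simp add: \<epsilon>_def)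
    then have "\<epsilon>\<^sup>2 > 0" by simp
    then obtain \<phi> where \<phi>: "\<phi> \<in> test_functions {c<..<d}"
      "integral {c..d} (\<lambda>x. (Q x - \<phi> x)\<^sup>2 + (deriv Q x - deriv \<phi> x)\<^sup>2) < \<epsilon>\<^sup>2"
      by (rule smooth_H1_approx_by_test_functions[OF \<open>c < d\<close> Q])
    have s: "smooth \<phi>" using \<phi>(1) by (rule test_functions_smooth)
    have c: "continuous_on {c..d} Q" "continuous_on {c..d} (deriv Q)"
      "continuous_on {c..d} \<phi>" "continuous_on {c..d} (deriv \<phi>)"
      using s Q(1) by (auto intro: smooth_continuous_on smooth_deriv)
    let ?S = "\<lambda>x. (Q x - \<phi> x)\<^sup>2 + (deriv Q x - deriv \<phi> x)\<^sup>2"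
    have Si: "?S integrable_on {c..d}"
      by (intro integrable_continuous_real continuous_intros c)
    have "\<bar>integral {c..d} (\<lambda>x. h x * deriv Q x)\<bar>
        = \<bar>integral {c..d} (\<lambda>x. h x * deriv Q x - h x * deriv \<phi> x)\<bar>"
      using zero[OF \<phi>(1)]
      by (simp add: integral_diff integrable_continuous_real continuous_on_mult h c)
    also have "\<dots> \<le> integral {c..d} (\<lambda>x. B * (\<epsilon> + ?S x * (1 / \<epsilon>)))"
      unfolding real_norm_def[symmetric]
    proof (rule integral_norm_bound_integral)
      show "norm (h x * deriv Q x - h x * deriv \<phi> x) \<le> B * (\<epsilon> + ?S x * (1 / \<epsilon>))"
        if x: "x \<in> {c..d}" for x
      proof -
        have "\<bar>deriv Q x - deriv \<phi> x\<bar> \<le> (\<epsilon> + (deriv Q x - deriv \<phi> x)\<^sup>2 * (1 / \<epsilon>)) / 2"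
          by (rule abs_le_young[OF \<open>\<epsilon> > 0\<close>])
        also have "\<dots> \<le> \<epsilon> + (deriv Q x - deriv \<phi> x)\<^sup>2 * (1 / \<epsilon>)"
        proof -
          have half: "y / 2 \<le> y" if "0 \<le> y" for y :: real using that by simp
          show ?thesis by (rule half) (use \<open>\<epsilon> > 0\<close> in simp)
        qed
        also have "\<dots> \<le> \<epsilon> + ?S x * (1 / \<epsilon>)"
          using \<open>\<epsilon> > 0\<close> by (intro add_left_mono mult_right_mono) auto
        finally have "\<bar>h x * (deriv Q x - deriv \<phi> x)\<bar> \<le> B * (\<epsilon> + ?S x * (1 / \<epsilon>))"
          unfolding abs_mult using B[OF x] \<open>B > 0\<close> by (intro mult_mono) auto
        then show ?thesis by (simp add: right_diff_distrib)
      qed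
    qed (intro integrable_continuous_real continuous_intros h c)+
    also have "\<dots> = B * ((d - c) * \<epsilon> + integral {c..d} ?S * (1 / \<epsilon>))"
    proof (rule integral_unique)
      have "((\<lambda>x. B * (\<epsilon> + ?S x * (1 / \<epsilon>))) has_integral
          B * (measure lborel {c..d} *\<^sub>R \<epsilon> + integral {c..d} ?S * (1 / \<epsilon>))) {c..d}"
        by (intro has_integral_mult_right has_integral_add has_integral_const_real
            has_integral_mult_left integrable_integral Si)
      then show "((\<lambda>x. B * (\<epsilon> + ?S x * (1 / \<epsilon>))) has_integral
          B * ((d - c) * \<epsilon> + integral {c..d} ?S * (1 / \<epsilon>))) {c..d}"
        using \<open>c < d\<close> by simp
    qed
    also have "\<dots> \<le> B * ((d - c) * \<epsilon> + \<epsilon>)"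
    proof (intro mult_left_mono add_left_mono)
      show "integral {c..d} ?S * (1 / \<epsilon>) \<le> \<epsilon>"
        using \<phi>(2) \<open>\<epsilon> > 0\<close> by (simp add: field_simps power2_eq_square)
    qed (use \<open>B > 0\<close> in auto)
    also have "\<dots> = (B * (d - c + 1)) * \<epsilon>" by (simp add: algebra_simps)
    also have "\<dots> = e"
      using \<open>B > 0\<close> \<open>c < d\<close> by (simp add: \<epsilon>_def)
    finally show ?thesis by simp
  qed
  then have "\<bar>integral {c..d} (\<lambda>x. h x * deriv Q x)\<bar> \<le> 0" by (rule field_le_epsilon)
  then show ?thesis by simp
qed

text \<open>The du Bois-Reymond lemma. A polynomial with mean value \<open>0\<close> is the derivative of a polynomial
vanishing at both end points, so \<open>h\<close> is orthogonal to it; hence \<open>h\<close> minus its mean value is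
orthogonal to all polynomials.\<close>
lemma weakly_constant_imp_constant:
  fixes h :: "real \<Rightarrow> real"
  assumes "c < d" and h: "continuous_on {c..d} h"
    and zero: "\<And>\<phi>. \<phi> \<in> test_functions {c<..<d} \<Longrightarrow> integral {c..d} (\<lambda>x. h x * deriv \<phi> x) = 0"
  obtains k where "\<And>x. x \<in> {c..d} \<Longrightarrow> h x = k"
proof -
  define mean where "mean u = integral {c..d} u / (d - c)" for u :: "real \<Rightarrow> real"
  have mean: "mean u * (d - c) = integral {c..d} u" for u
    using \<open>c < d\<close> by (simp add: mean_def)
  have "integral {c..d} (\<lambda>x. (h x - mean h) * poly p x) = 0" for p
  proof -
    obtain q where q: "pderiv q = p - [:mean (poly p):]"
      using ex_poly_antiderivative by blast
    define Q where "Q = q - [:poly q c:]"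
    have dQ: "deriv (poly Q) = (\<lambda>x. poly p x - mean (poly p))"
      by (simp add: deriv_poly Q_def pderiv_diff q pderiv_pCons fun_eq_iff)
    have pi: "poly p integrable_on {c..d}"
      by (intro integrable_continuous_real continuous_intros)
    have "poly Q d - poly Q c = integral {c..d} (\<lambda>x. poly p x - mean (poly p))"
    proof (rule integral_unique[symmetric], rule fundamental_theorem_of_calculus)
      show "(poly Q has_vector_derivative poly p x - mean (poly p)) (at x within {c..d})" for x
        using smooth_DERIV[OF smooth_poly, of Q x] unfolding dQ
        by (simp add: has_field_derivative_at_within flip: has_real_derivative_iff_has_vector_derivative)
    qed (use \<open>c < d\<close> in auto)
    also have "\<dots> = 0"
      using mean[of "poly p"] \<open>c < d\<close>
      by (subst integral_diff[OF pi integrable_const_ivl]) (simp add: mult.commute)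
    finally have "poly Q c = 0" "poly Q d = 0" by (simp_all add: Q_def)
    then have orth: "integral {c..d} (\<lambda>x. h x * (poly p x - mean (poly p))) = 0"
      using weakly_constant_orthogonal_to_derivs[OF \<open>c < d\<close> h zero smooth_poly[of Q]] by (simp add: dQ)
    have int: "(\<lambda>x. h x * poly p x) integrable_on {c..d}" "h integrable_on {c..d}"
      by (intro integrable_continuous_real continuous_intros h)+
    have "integral {c..d} (\<lambda>x. h x * poly p x) = integral {c..d} h * mean (poly p)"
      using orth int by (simp add: right_diff_distrib integral_diff integrable_on_mult_left)
    moreover have "integral {c..d} (\<lambda>x. (h x - mean h) * poly p x)
        = integral {c..d} (\<lambda>x. h x * poly p x) - mean h * integral {c..d} (poly p)"
      using int pi by (simp add: left_diff_distrib integral_diff integrable_on_mult_right)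
    ultimately show ?thesis
      by (simp add: mean_def)
  qed
  then have "h x - mean h = 0" if "x \<in> {c..d}" for x
    by (rule continuous_orthogonal_to_polys_imp_zero[OF \<open>c < d\<close> continuous_on_diff[OF h continuous_on_const] _ that])
  then show thesis using that by auto
qed

section \<open>The weak equation\<close>
definition double_integral :: "(real \<Rightarrow> real) \<Rightarrow> real \<Rightarrow> real" where
  "double_integral f x = integral {-pi..x} (\<lambda>t. integral {-pi..t} f)"

lemma double_integral_DERIV:
  assumes "f integrable_on {-pi..pi}" "x \<in> {-pi..pi}"
  shows "(double_integral f has_real_derivative integral {-pi..x} f) (at x within {-pi..pi})"
  unfolding double_integral_def
  by (rule integral_has_real_derivative[OF indefinite_integral_continuous_1]) (use assms in auto)

lemma continuous_double_integral:
  "f integrable_on {-pi..pi} \<Longrightarrow> continuous_on {-pi..pi} (double_integral f)"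
  by (rule DERIV_continuous_on[OF double_integral_DERIV])

text \<open>The linear function subtracted from the double integral makes \<open>G\<close> vanish at both end points, so
that no boundary terms involving the derivative of \<open>v\<close> survive. The constant slope it contributes to
the derivative of \<open>G\<close> is invisible since \<open>v'\<close> has mean value \<open>0\<close>.\<close>
lemma integral_times_smooth_by_parts_twice:
  fixes f :: "real \<Rightarrow> real"
  assumes f: "f absolutely_integrable_on {-pi..pi}" and B: "\<And>x. \<bar>f x\<bar> \<le> B"
    and v: "smooth v" "v pi = 0" "v (- pi) = 0"
    and G: "G = (\<lambda>x. double_integral f x - double_integral f pi / (2 * pi) * (x + pi))"
  shows "integral {-pi..pi} (\<lambda>x. f x * v x) = integral {-pi..pi} (\<lambda>x. G x * deriv (deriv v) x)"
proof -
  define \<Phi> where "\<Phi> x = integral {-pi..x} f" for x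
  define k where "k = double_integral f pi / (2 * pi)"
  have fi: "f integrable_on {-pi..pi}" using f absolutely_integrable_on_def by blast
  have \<Phi>: "continuous_on {-pi..pi} \<Phi>"
    unfolding \<Phi>_def by (rule indefinite_integral_continuous_1[OF fi])
  have cv: "continuous_on {-pi..pi} (deriv v)" "continuous_on {-pi..pi} (deriv (deriv v))"
    using v(1) by (auto intro: smooth_continuous_on smooth_deriv)
  have Gc: "continuous_on {-pi..pi} G"
    unfolding G by (intro continuous_intros continuous_double_integral fi)
  have ends: "G pi = 0" "G (- pi) = 0"
    by (simp_all add: G double_integral_def)
  have "((\<lambda>x. \<Phi> x * deriv v x - k * deriv v x + G x * deriv (deriv v) x) has_integral
      G pi * deriv v pi - G (- pi) * deriv v (- pi)) {-pi..pi}"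
  proof (rule fundamental_theorem_of_calculus_interior)
    show "((\<lambda>x. G x * deriv v x) has_vector_derivative
        \<Phi> x * deriv v x - k * deriv v x + G x * deriv (deriv v) x) (at x)" if x: "x \<in> {-pi<..<pi}" for x
    proof -
      have "(double_integral f has_real_derivative \<Phi> x) (at x within {-pi..pi})"
        unfolding \<Phi>_def using x by (intro double_integral_DERIV fi) auto
      then have "(double_integral f has_real_derivative \<Phi> x) (at x)"
        using x by (rule DERIV_within_Icc_interior)
      then have "(G has_real_derivative \<Phi> x - k) (at x)"
        unfolding G k_def[symmetric] by (auto intro!: derivative_eq_intros)
      from DERIV_mult[OF this smooth_DERIV[OF smooth_deriv[OF v(1)]]] show ?thesis
        by (simp add: has_real_derivative_iff_has_vector_derivative algebra_simps)
    qed
  qed (intro continuous_on_mult Gc cv | simp)+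
  then have 0: "integral {-pi..pi} (\<lambda>x. \<Phi> x * deriv v x - k * deriv v x + G x * deriv (deriv v) x) = 0"
    by (simp add: integral_unique ends)
  have int: "(\<lambda>x. \<Phi> x * deriv v x) integrable_on {-pi..pi}" "(\<lambda>x. G x * deriv (deriv v) x) integrable_on {-pi..pi}"
    "deriv v integrable_on {-pi..pi}"
    by (intro integrable_continuous_real continuous_on_mult \<Phi> Gc cv)+
  have "(deriv v has_integral v pi - v (- pi)) {-pi..pi}"
    using smooth_DERIV[OF v(1)]
    by (intro fundamental_theorem_of_calculus)
      (auto simp: has_real_derivative_iff_has_vector_derivative[symmetric] has_field_derivative_at_within)
  then have dv: "integral {-pi..pi} (deriv v) = 0" using v by (simp add: integral_unique)
  have "integral {-pi..pi} (\<lambda>x. \<Phi> x * deriv v x - k * deriv v x + G x * deriv (deriv v) x)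
      = integral {-pi..pi} (\<lambda>x. \<Phi> x * deriv v x) - k * integral {-pi..pi} (deriv v)
        + integral {-pi..pi} (\<lambda>x. G x * deriv (deriv v) x)"
    by (intro integral_unique has_integral_add has_integral_diff has_integral_mult_right integrable_integral int)
  then show ?thesis
    using 0 dv integration_by_parts_bounded[OF _ f B v(1)] v by (simp add: \<Phi>_def)
qed

text \<open>The polynomials \<open>v1\<close> and \<open>v2\<close> vanish at \<open>\<plusminus>pi\<close> and interpolate the values \<open>1, 0\<close> and \<open>0, 1\<close> at
\<open>b, -b\<close>. Given a polynomial \<open>p\<close>, choose \<open>q\<close> with \<open>q'' = p\<close> vanishing at \<open>\<plusminus>pi\<close>, and subtract
\<open>q(b) v1 + q(-b) v2\<close> to obtain an admissible \<open>r\<close>. The equation for \<open>r\<close> says that integrating \<open>p\<close>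
against \<open>w - G\<close> gives \<open>q(b) c1 + q(-b) c2\<close>, where \<open>c1\<close> and \<open>c2\<close> do not depend on \<open>p\<close>; and \<open>q(\<plusminus>b)\<close> is
the integral of \<open>p\<close> against the Green functions.\<close>
lemma weak_equation_representation:
  fixes w f :: "real \<Rightarrow> real"
  assumes b: "0 < b" "b < pi" and w: "w absolutely_integrable_on {-pi..pi}"
    and f: "f absolutely_integrable_on {-pi..pi}" and B: "\<And>x. \<bar>f x\<bar> \<le> B"
    and eq: "\<And>p. poly p pi = 0 \<Longrightarrow> poly p (- pi) = 0 \<Longrightarrow> poly p b = 0 \<Longrightarrow> poly p (- b) = 0 \<Longrightarrow>
      integral {-pi..pi} (\<lambda>x. w x * poly (pderiv (pderiv p)) x) = integral {-pi..pi} (\<lambda>x. f x * poly p x)"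
  obtains c1 c2 where "AE x in lebesgue_on {-pi<..<pi}.
    w x = double_integral f x - double_integral f pi / (2 * pi) * (x + pi)
      + c1 * point_kernel b x + c2 * point_kernel (- b) x"
proof -
  define G where "G = (\<lambda>x. double_integral f x - double_integral f pi / (2 * pi) * (x + pi))"
  have fi: "f integrable_on {-pi..pi}" using f absolutely_integrable_on_def by blast
  have Gc: "continuous_on {-pi..pi} G"
    unfolding G_def by (intro continuous_intros continuous_double_integral fi)
  have wG: "(\<lambda>x. w x - G x) absolutely_integrable_on {-pi..pi}"
    by (intro set_integral_diff w absolutely_integrable_continuous_real Gc)
  have pint: "(\<lambda>x. u x * poly p x) integrable_on {-pi..pi}" if "u absolutely_integrable_on {-pi..pi}" for u p
  proof -
    have "continuous_on {-pi..pi} (poly p)" by (intro continuous_intros)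
    from continuous_times_absolutely_integrable[OF this that] show ?thesis
      by (simp add: absolutely_integrable_on_def mult.commute)
  qed
  define N where "N = (pi\<^sup>2 - b\<^sup>2) * (2 * b)"
  have "b\<^sup>2 < pi\<^sup>2" using b by (intro power_strict_mono) auto
  then have N: "N \<noteq> 0" using b by (simp add: N_def)
  define v1 where "v1 = smult (1 / N) ([:pi\<^sup>2, 0, -1:] * [:b, 1:])"
  define v2 where "v2 = smult (1 / N) ([:pi\<^sup>2, 0, -1:] * [:b, -1:])"
  have v1: "poly v1 pi = 0" "poly v1 (- pi) = 0" "poly v1 b = 1" "poly v1 (- b) = 0"
    and v2: "poly v2 pi = 0" "poly v2 (- pi) = 0" "poly v2 b = 0" "poly v2 (- b) = 1"
  proof -
    have "poly ([:pi\<^sup>2, 0, -1:] * [:b, 1:]) b = N" "poly ([:pi\<^sup>2, 0, -1:] * [:b, -1:]) (- b) = N"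
      by (simp_all add: N_def power2_eq_square algebra_simps)
    then show "poly v1 b = 1" "poly v2 (- b) = 1"
      using N by (simp_all only: v1_def v2_def poly_smult) simp_all
  qed (simp_all add: v1_def v2_def power2_eq_square algebra_simps)
  define I where "I p = integral {-pi..pi} (\<lambda>x. (w x - G x) * poly p x)" for p
  define c1 where "c1 = I (pderiv (pderiv v1))"
  define c2 where "c2 = I (pderiv (pderiv v2))"
  define h where "h x = w x - G x - (c1 * point_kernel b x + c2 * point_kernel (- b) x)" for x
  have I_lin: "I (p - smult s q - smult t r) = I p - s * I q - t * I r" for p q r s t
  proof -
    have "I (p - smult s q - smult t r) = integral {-pi..pi}
        (\<lambda>x. (w x - G x) * poly p x - s * ((w x - G x) * poly q x) - t * ((w x - G x) * poly r x))"
      by (simp add: I_def algebra_simps)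
    also have "\<dots> = I p - s * I q - t * I r"
      unfolding I_def
      by (intro integral_unique has_integral_diff has_integral_mult_right integrable_integral pint[OF wG])
    finally show ?thesis .
  qed
  have kc: "continuous_on {-pi..pi} (\<lambda>x. c1 * point_kernel b x + c2 * point_kernel (- b) x)"
    by (intro continuous_intros continuous_point_kernel)
  have "AE x in lebesgue_on {-pi<..<pi}. h x = 0"
  proof (rule orthogonal_to_polys_imp_AE_zero)
    show "h absolutely_integrable_on {-pi..pi}"
      unfolding h_def by (intro set_integral_diff wG absolutely_integrable_continuous_real kc)
    show "integral {-pi..pi} (\<lambda>x. h x * poly p x) = 0" for p
    proof -
      obtain q where q: "pderiv (pderiv q) = p" "poly q (- pi) = 0" "poly q pi = 0"
        using ex_poly_second_antiderivative_zero_boundary[of "- pi" pi p] by auto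
      define r where "r = q - smult (poly q b) v1 - smult (poly q (- b)) v2"
      have r: "poly r pi = 0" "poly r (- pi) = 0" "poly r b = 0" "poly r (- b) = 0"
        by (simp_all add: r_def v1 v2 q)
      have "integral {-pi..pi} (\<lambda>x. f x * poly r x)
          = integral {-pi..pi} (\<lambda>x. G x * deriv (deriv (poly r)) x)"
        using integral_times_smooth_by_parts_twice[OF f B smooth_poly r(1,2) G_def] .
      then have "integral {-pi..pi} (\<lambda>x. w x * poly (pderiv (pderiv r)) x)
          = integral {-pi..pi} (\<lambda>x. G x * poly (pderiv (pderiv r)) x)"
        using eq[OF r] by (simp add: deriv_poly)
      then have "I (pderiv (pderiv r)) = 0"
        using pint[OF w] pint[OF absolutely_integrable_continuous_real[OF Gc]]
        by (simp add: I_def left_diff_distrib integral_diff)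
      moreover have "pderiv (pderiv r) = p - smult (poly q b) (pderiv (pderiv v1))
          - smult (poly q (- b)) (pderiv (pderiv v2))"
        by (simp add: r_def pderiv_diff pderiv_smult q)
      ultimately have Ip: "I p = poly q b * c1 + poly q (- b) * c2"
        by (simp add: I_lin c1_def c2_def)
      have kernel: "((\<lambda>x. point_kernel s x * poly p x) has_integral poly q s) {-pi..pi}"
        if "- pi \<le> s" "s \<le> pi" for s
      proof -
        have "continuous_on {-pi..pi} (\<lambda>x. point_kernel s x * poly p x)"
          by (intro continuous_intros continuous_point_kernel)
        then show ?thesis
          using integral_point_kernel[OF that smooth_poly q(3,2)] integrable_continuous_real
          by (metis (no_types, lifting) deriv_poly has_integral_integrable_integral integral_cong q(1))
      qed
      have "((\<lambda>x. (w x - G x) * poly p x - (c1 * (point_kernel b x * poly p x)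
          + c2 * (point_kernel (- b) x * poly p x))) has_integral
          I p - (c1 * poly q b + c2 * poly q (- b))) {-pi..pi}"
        unfolding I_def using b
        by (intro has_integral_diff has_integral_add has_integral_mult_right integrable_integral pint[OF wG] kernel) auto
      also have "(\<lambda>x. (w x - G x) * poly p x - (c1 * (point_kernel b x * poly p x)
          + c2 * (point_kernel (- b) x * poly p x))) = (\<lambda>x. h x * poly p x)"
        by (simp add: h_def algebra_simps)
      finally show ?thesis
        using Ip by (simp add: integral_unique)
    qed
  qed
  then have "AE x in lebesgue_on {-pi<..<pi}. w x = double_integral f x - double_integral f pi / (2 * pi) * (x + pi)
      + c1 * point_kernel b x + c2 * point_kernel (- b) x"
    by (rule AE_mp) (simp add: h_def G_def)
  then show thesis by (rule that)
qed

text \<open>The difference between \<open>e'\<close> and an indefinite integral of \<open>W\<close> is continuous with vanishing weak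
derivative, hence constant.\<close>
lemma weak_second_deriv_imp_classical:
  fixes e e' W :: "real \<Rightarrow> real"
  assumes "c < d" and e: "continuous_on {c..d} e" "continuous_on {c..d} e'" and W: "continuous_on {c..d} W"
    and D: "\<And>x. x \<in> {c<..<d} \<Longrightarrow> (e has_real_derivative e' x) (at x)"
    and weak: "\<And>\<phi>. \<phi> \<in> test_functions {c<..<d} \<Longrightarrow>
      integral {c..d} (\<lambda>x. e x * deriv (deriv \<phi>) x) = integral {c..d} (\<lambda>x. W x * \<phi> x)"
    and x: "x \<in> {c..d}"
  shows "(e' has_real_derivative W x) (at x within {c..d})"
proof -
  define \<Psi> where "\<Psi> x = integral {c..x} W" for x
  have \<Psi>_D: "(\<Psi> has_real_derivative W x) (at x within {c..d})" if "x \<in> {c..d}" for x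
    unfolding \<Psi>_def by (rule integral_has_real_derivative[OF W that])
  then have \<Psi>: "continuous_on {c..d} \<Psi>"
    by (rule DERIV_continuous_on)
  have LINT: "(LINT x|lebesgue_on {c<..<d}. u x * \<phi> x) = integral {c..d} (\<lambda>x. u x * \<phi> x)"
    if "continuous_on {c..d} u" "smooth \<phi>" for u \<phi>
    using that by (intro LINT_Ioo_eq_integral absolutely_integrable_continuous_real continuous_on_mult)
      (auto intro: smooth_continuous_on)
  have parts: "integral {c..d} (\<lambda>x. u x * deriv \<phi> x) = - integral {c..d} (\<lambda>x. u' x * \<phi> x)"
    if "continuous_on {c..d} u" "continuous_on {c..d} u'" "\<And>x. x \<in> {c<..<d} \<Longrightarrow> (u has_real_derivative u' x) (at x)"
      and \<phi>: "\<phi> \<in> test_functions {c<..<d}" for u u' \<phi>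
  proof -
    have s: "smooth \<phi>" "smooth (deriv \<phi>)"
      using test_functions_smooth[OF \<phi>] by (auto intro: smooth_deriv)
    have "(LINT x|lebesgue_on {c<..<d}. u x * deriv \<phi> x) = - (LINT x|lebesgue_on {c<..<d}. u' x * \<phi> x)"
      using C1_has_weak_deriv[OF _ that(1-3)] \<phi> \<open>c < d\<close> by (simp add: has_weak_deriv_def)
    then show ?thesis
      by (simp only: LINT[OF that(1) s(2)] LINT[OF that(2) s(1)])
  qed
  have hc: "continuous_on {c..d} (\<lambda>x. e' x - \<Psi> x)"
    by (intro continuous_on_diff e \<Psi>)
  have "integral {c..d} (\<lambda>x. (e' x - \<Psi> x) * deriv \<phi> x) = 0" if \<phi>: "\<phi> \<in> test_functions {c<..<d}" for \<phi>
  proof -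
    have s: "continuous_on {c..d} (deriv \<phi>)"
      using test_functions_smooth[OF \<phi>] by (intro smooth_continuous_on smooth_deriv)
    have "integral {c..d} (\<lambda>x. \<Psi> x * deriv \<phi> x) = - integral {c..d} (\<lambda>x. W x * \<phi> x)"
      using \<Psi> W DERIV_within_Icc_interior[OF \<Psi>_D] \<phi> by (intro parts) auto
    moreover have "integral {c..d} (\<lambda>x. e x * deriv (deriv \<phi>) x) = - integral {c..d} (\<lambda>x. e' x * deriv \<phi> x)"
      using e D deriv_test_function[OF \<phi>] by (intro parts)
    ultimately show ?thesis
      using weak[OF \<phi>] by (simp add: left_diff_distrib integral_diff integrable_continuous_real continuous_on_mult e \<Psi> s)
  qed
  then obtain k where k: "\<And>x. x \<in> {c..d} \<Longrightarrow> e' x - \<Psi> x = k"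
    using weakly_constant_imp_constant[OF \<open>c < d\<close> hc] by blast
  have "((\<lambda>x. \<Psi> x + k) has_real_derivative W x) (at x within {c..d})"
    using DERIV_add[OF \<Psi>_D[OF x] DERIV_const[of k]] by simp
  then show ?thesis
    by (rule has_field_derivative_transform_within[OF _ zero_less_one x]) (use k in force)
qed

text \<open>\<open>F\<close> is the double integral of the right-hand side and \<open>\<Phi>\<close> its first integral. Once the second
derivative \<open>W\<close> differs from \<open>F\<close> on a piece only by an affine function, the third derivative there is
\<open>\<Phi>\<close> plus a constant and is differentiable wherever \<open>\<Phi>\<close> is.\<close>
lemma third_derivative_on_piece:
  fixes e e' W \<Phi> F :: "real \<Rightarrow> real"
  assumes st: "c \<le> s" "s < t" "t \<le> d"
    and e: "\<And>x. x \<in> {c..d} \<Longrightarrow> (e has_real_derivative e' x) (at x within {c..d})"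
      "\<And>x. x \<in> {c..d} \<Longrightarrow> (e' has_real_derivative W x) (at x within {c..d})"
    and F: "\<And>x. x \<in> {c..d} \<Longrightarrow> (F has_real_derivative \<Phi> x) (at x within {c..d})"
    and \<Phi>: "continuous_on {c..d} \<Phi>"
    and W: "\<And>x. x \<in> {s..t} \<Longrightarrow> W x = F x + m * x + q"
  shows "e \<in> C_on 3 {s..t}"
    and "\<And>x y. x \<in> {s<..<t} \<Longrightarrow> (\<Phi> has_real_derivative y) (at x) \<Longrightarrow>
      ((deriv ^^ 3) e has_real_derivative y) (at x)"
proof -
  have sub: "{s..t} \<subseteq> {c..d}" using st by auto
  have W_D: "(W has_real_derivative \<Phi> x + m) (at x within {s..t})" if x: "x \<in> {s..t}" for x
  proof -
    have "((\<lambda>x. F x + m * x + q) has_real_derivative \<Phi> x + m) (at x within {s..t})"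
      using DERIV_subset[OF F sub, of x] x sub by (auto intro!: derivative_eq_intros)
    then show ?thesis
      by (rule has_field_derivative_transform_within[OF _ zero_less_one x]) (use W in force)
  qed
  define D where "D j = (if j = 0 then e else if j = 1 then e' else if j = 2 then W else (\<lambda>x. \<Phi> x + m))" for j :: nat
  show "e \<in> C_on 3 {s..t}"
  proof (rule C_on_IccI[of s t e D])
    show "(D j has_real_derivative D (Suc j) x) (at x within {s..t})" if "j < 3" "x \<in> {s..t}" for j x
    proof -
      have "j = 0 \<or> j = 1 \<or> j = 2" using that by auto
      then show ?thesis
        using that sub DERIV_subset[OF e(1) sub] DERIV_subset[OF e(2) sub] W_D by (auto simp: D_def)
    qed
    show "continuous_on {s..t} (D 3)"
      unfolding D_def using continuous_on_subset[OF \<Phi> sub] by (auto intro!: continuous_intros)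
  qed (use st in \<open>auto simp: D_def\<close>)
  fix x y assume x: "x \<in> {s<..<t}" and y: "(\<Phi> has_real_derivative y) (at x)"
  have int: "z \<in> {c<..<d}" "z \<in> {c..d}" "z \<in> {s..t}" if "z \<in> {s<..<t}" for z
    using that st by auto
  have d1: "deriv e z = e' z" if "z \<in> {s<..<t}" for z
    by (rule DERIV_imp_deriv[OF DERIV_within_Icc_interior[OF e(1)]]) (use int[OF that] in auto)
  have d2: "deriv (deriv e) z = W z" if z: "z \<in> {s<..<t}" for z
  proof (rule DERIV_imp_deriv, rule has_field_derivative_transform_within_open[of _ _ _ "{s<..<t}"])
    show "(e' has_real_derivative W z) (at z)"
      by (rule DERIV_within_Icc_interior[OF e(2)]) (use int[OF z] in auto)
  qed (use z d1 in auto)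
  have d3: "deriv (deriv (deriv e)) z = \<Phi> z + m" if z: "z \<in> {s<..<t}" for z
  proof (rule DERIV_imp_deriv, rule has_field_derivative_transform_within_open[of _ _ _ "{s<..<t}"])
    show "(W has_real_derivative \<Phi> z + m) (at z)"
      by (rule DERIV_within_Icc_interior[OF W_D]) (use int[OF z] z in auto)
  qed (use z d2 in auto)
  have "((deriv (deriv (deriv e))) has_real_derivative y) (at x)"
  proof (rule has_field_derivative_transform_within_open[of _ _ _ "{s<..<t}"])
    show "((\<lambda>x. \<Phi> x + m) has_real_derivative y) (at x)"
      using DERIV_add[OF y DERIV_const[of m]] by simp
  qed (use x d3 in auto)
  then show "((deriv ^^ 3) e has_real_derivative y) (at x)"
    by (simp add: numeral_3_eq_3)
qed

lemma L2_on_imp_integrable: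
  assumes "w \<in> L2_on {c<..<d}"
  shows "integrable (lebesgue_on {c<..<d}) w"
proof (rule measurable_bounded_by_integrable_imp_lebesgue_integrable[where g="\<lambda>x. 1 + (w x)\<^sup>2"])
  have "finite_measure (lebesgue_on {c<..<d})"
    by (rule finite_measure_lebesgue_on) auto
  then show "integrable (lebesgue_on {c<..<d}) (\<lambda>x. 1 + (w x)\<^sup>2)"
    using assms by (simp add: L2_on_def finite_measure.integrable_const)
  show "norm (w x) \<le> 1 + (w x)\<^sup>2" for x
  proof -
    have "0 \<le> (\<bar>w x\<bar> - 1)\<^sup>2" by simp
    then have "2 * \<bar>w x\<bar> \<le> 1 + (w x)\<^sup>2" by (simp add: power2_diff)
    then show ?thesis by simp
  qed
qed (use assms in \<open>auto simp: L2_on_def\<close>)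

section \<open>Regularity of solutions of the weak equation\<close>
theorem proposition2p5:
  fixes \<alpha> \<beta> a lam :: real and p e :: "real \<Rightarrow> real"
  assumes "0 < \<alpha>" "\<alpha> < 1" "1 < \<beta>"
    and "0 < a" "a < 1"
    and "p \<in> P_class \<alpha> \<beta>"
    and "e \<in> V_space a"
    and "\<And>v. v \<in> V_space a \<Longrightarrow>
      (LINT x|lebesgue_on II. weak_deriv II 2 e x * weak_deriv II 2 v x)
        = lam * (LINT x|lebesgue_on II. p x * e x * v x)"
  shows "solves_ode_ae a lam p e
    \<and> e pi = 0 \<and> e (- pi) = 0
    \<and> deriv_within (closure II) 2 e pi = 0 \<and> deriv_within (closure II) 2 e (- pi) = 0
    \<and> e (a * pi) = 0 \<and> e (- a * pi) = 0
    \<and> e \<in> C_on 2 (closure II)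
    \<and> e \<in> C_on 3 (closure (I_minus a))
    \<and> e \<in> C_on 3 (closure (I_zero a))
    \<and> e \<in> C_on 3 (closure (I_plus a))"
proof -
  define b where "b = a * pi"
  have b: "0 < b" "b < pi" and ab: "a * pi = b" "- a * pi = - b"
    using assms(4,5) by (simp_all add: b_def)
  have e: "e \<in> sobolev_H 2 II" "e \<in> sobolev_H10 II" "e \<in> C_on 1 {-pi..pi}" "e b = 0" "e (- b) = 0"
    using assms(7) by (auto simp: V_space_def closure_II ab)
  obtain e' where e'c: "continuous_on {-pi..pi} e" "continuous_on {-pi..pi} e'"
    and e'D: "\<And>x. x \<in> {-pi..pi} \<Longrightarrow> (e has_real_derivative e' x) (at x within {-pi..pi})"
    using C_on_1_IccD[OF _ e(3)] by auto
  have e'D_int: "(e has_real_derivative e' x) (at x)" if "x \<in> {-pi<..<pi}" for x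
    using that by (intro DERIV_within_Icc_interior[OF e'D]) auto
  have e_ends: "e pi = 0" "e (- pi) = 0"
    using sobolev_H10_vanishes_at_endpoints[OF _ e(2)[unfolded II_def] e'c e'D_int] by auto

  define w where "w = weak_deriv II 2 e"
  have "\<exists>w2\<in>L2_on II. has_weak_deriv II 2 e w2"
    using e(1) by (simp add: sobolev_H_def)
  then obtain w2 where w2: "w2 \<in> L2_on II" "has_weak_deriv II 2 e w2" ..
  have II: "open II" "II \<in> sets lebesgue" by (auto simp: II_def)
  have w: "has_weak_deriv II 2 e w"
    unfolding w_def by (rule has_weak_deriv_weak_deriv[OF w2(2)])
  have w_AE: "AE x in lebesgue_on II. w x = w2 x"
    by (rule weak_deriv_unique[OF w w2(2) II(1)])
  have w_meas: "w \<in> borel_measurable (lebesgue_on II)"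
    using w2(1) by (intro borel_measurable_lebesgue_on_AE_cong[OF _ II(2) w_AE]) (simp add: L2_on_def)
  have w2_int: "integrable (lebesgue_on II) w2"
    using L2_on_imp_integrable w2(1) by (simp add: II_def)
  have "integrable (lebesgue_on II) w"
    by (rule iffD2[OF integrable_cong_AE[OF w_meas borel_measurable_integrable[OF w2_int] w_AE] w2_int])
  then have w_int: "w absolutely_integrable_on {-pi..pi}"
    by (simp add: II_def integrable_Ioo_iff_absolutely_integrable)

  obtain E where "E > 0" and E: "\<And>x. x \<in> {-pi..pi} \<Longrightarrow> \<bar>e x\<bar> \<le> E"
    using compact_imp_bounded[OF compact_continuous_image[OF e'c(1)]] by (auto simp: bounded_pos)
  define B where "B = \<bar>lam\<bar> * \<beta> * E"
  have "B \<ge> 0" using assms(3) \<open>E > 0\<close> by (simp add: B_def)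
  \<comment> \<open>The right-hand side is bounded only almost everywhere; truncating it gives a function with
    the same integrals which is bounded everywhere, as \<open>integration_by_parts_bounded\<close> requires.\<close>
  define f where "f x = (if \<bar>lam * p x * e x\<bar> \<le> B then lam * p x * e x else 0)" for x
  have f_bound: "\<bar>f x\<bar> \<le> B" for x
    using \<open>B \<ge> 0\<close> by (simp add: f_def)
  have p: "p \<in> borel_measurable (lebesgue_on II)" "AE x in lebesgue_on II. \<alpha> \<le> p x \<and> p x \<le> \<beta>"
    using assms(6) by (auto simp: P_class_def Linf_on_def)
  have f_AE: "AE x in lebesgue_on II. f x = lam * p x * e x"
  proof (rule lebesgue_on_mono[OF p(2)])
    fix x assume x: "\<alpha> \<le> p x \<and> p x \<le> \<beta>" "x \<in> II"
    have "\<bar>p x\<bar> \<le> \<beta>" "\<bar>e x\<bar> \<le> E"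
      using x assms(1) E[of x] by (auto simp: II_def)
    then have "\<bar>lam * p x * e x\<bar> \<le> B"
      unfolding B_def abs_mult by (intro mult_mono) (use assms(3) \<open>E > 0\<close> in auto)
    then show "f x = lam * p x * e x" by (simp add: f_def)
  qed
  have e_meas: "e \<in> borel_measurable (lebesgue_on II)"
    using continuous_in_L2_on[OF e'c(1)] by (simp add: L2_on_def II_def)
  have g_meas: "(\<lambda>x. lam * p x * e x) \<in> borel_measurable (lebesgue_on II)"
    using p(1) e_meas by (intro borel_measurable_times borel_measurable_const)
  have f_meas: "f \<in> borel_measurable (lebesgue_on II)"
    by (rule borel_measurable_lebesgue_on_AE_cong[OF g_meas II(2) f_AE])
  have "integrable (lebesgue_on II) f"
  proof (rule measurable_bounded_by_integrable_imp_lebesgue_integrable[OF f_meas _ _ II(2)])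
    show "integrable (lebesgue_on II) (\<lambda>_. B)"
      by (intro finite_measure.integrable_const finite_measure_lebesgue_on) (auto simp: II_def)
  qed (use f_bound in auto)
  then have f_int: "f absolutely_integrable_on {-pi..pi}"
    by (simp add: II_def integrable_Ioo_iff_absolutely_integrable)
  have fi: "f integrable_on {-pi..pi}"
    using f_int absolutely_integrable_on_def by blast

  have weak_eq: "integral {-pi..pi} (\<lambda>x. w x * deriv (deriv v) x) = lam * (LINT x|lebesgue_on II. p x * e x * v x)"
    "integral {-pi..pi} (\<lambda>x. f x * v x) = lam * (LINT x|lebesgue_on II. p x * e x * v x)"
    if v: "smooth v" "v \<in> V_space a" for v
  proof -
    have vc: "continuous_on {-pi..pi} v" "continuous_on {-pi..pi} (deriv (deriv v))"
      using v(1) by (auto intro: smooth_continuous_on smooth_deriv)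
    have vm: "v \<in> borel_measurable (lebesgue_on II)" "deriv (deriv v) \<in> borel_measurable (lebesgue_on II)"
      using vc[THEN continuous_in_L2_on] by (auto simp: L2_on_def II_def)
    have v_AE: "AE x in lebesgue_on II. weak_deriv II 2 v x = deriv (deriv v) x"
      using smooth_has_weak_deriv(2)[of "-pi" pi v] v(1) II(1)
      by (intro weak_deriv_AE_eq) (auto simp: II_def)
    have wv_meas: "weak_deriv II 2 v \<in> borel_measurable (lebesgue_on II)"
      by (rule borel_measurable_lebesgue_on_AE_cong[OF vm(2) II(2) v_AE])
    have "integral {-pi..pi} (\<lambda>x. w x * deriv (deriv v) x) = (LINT x|lebesgue_on II. w x * deriv (deriv v) x)"
      using continuous_times_absolutely_integrable[OF vc(2) w_int]
      unfolding II_def by (intro LINT_Ioo_eq_integral[symmetric]) (simp add: mult.commute)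
    also have "\<dots> = (LINT x|lebesgue_on II. weak_deriv II 2 e x * weak_deriv II 2 v x)"
      unfolding w_def[symmetric]
    proof (rule integral_cong_AE)
      show "AE x in lebesgue_on II. w x * deriv (deriv v) x = w x * weak_deriv II 2 v x"
        by (rule lebesgue_on_mono[OF v_AE]) simp
    qed (intro borel_measurable_times w_meas vm wv_meas)+
    also have "\<dots> = lam * (LINT x|lebesgue_on II. p x * e x * v x)"
      by (rule assms(8)[OF v(2)])
    finally show "integral {-pi..pi} (\<lambda>x. w x * deriv (deriv v) x) = lam * (LINT x|lebesgue_on II. p x * e x * v x)" .
    have "integral {-pi..pi} (\<lambda>x. f x * v x) = (LINT x|lebesgue_on II. f x * v x)"
      using continuous_times_absolutely_integrable[OF vc(1) f_int]
      unfolding II_def by (intro LINT_Ioo_eq_integral[symmetric]) (simp add: mult.commute)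
    also have "\<dots> = (LINT x|lebesgue_on II. lam * (p x * e x * v x))"
    proof (rule integral_cong_AE)
      show "AE x in lebesgue_on II. f x * v x = lam * (p x * e x * v x)"
        by (rule lebesgue_on_mono[OF f_AE]) simp
    qed (intro borel_measurable_times borel_measurable_const f_meas p(1) e_meas vm)+
    finally show "integral {-pi..pi} (\<lambda>x. f x * v x) = lam * (LINT x|lebesgue_on II. p x * e x * v x)"
      by simp
  qed

  define F where "F = double_integral f"
  define \<Phi> where "\<Phi> x = integral {-pi..x} f" for x
  define k0 where "k0 = F pi / (2 * pi)"
  have poly_eq: "integral {-pi..pi} (\<lambda>x. w x * poly (pderiv (pderiv q)) x) = integral {-pi..pi} (\<lambda>x. f x * poly q x)"
    if "poly q pi = 0" "poly q (- pi) = 0" "poly q b = 0" "poly q (- b) = 0" for q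
  proof -
    have "poly q \<in> V_space a"
      using that ab by (intro smooth_in_V_space smooth_poly) auto
    then show ?thesis
      using weak_eq[OF smooth_poly, of q] by (simp add: deriv_poly)
  qed
  obtain c1 c2 where rep: "AE x in lebesgue_on {-pi<..<pi}.
      w x = F x - k0 * (x + pi) + c1 * point_kernel b x + c2 * point_kernel (- b) x"
    using weak_equation_representation[OF b w_int f_int f_bound poly_eq]
    unfolding F_def k0_def by blast
  define W where "W x = F x - k0 * (x + pi) + c1 * point_kernel b x + c2 * point_kernel (- b) x" for x
  have Fc: "continuous_on {-pi..pi} F"
    unfolding F_def by (rule continuous_double_integral[OF fi])
  have FD: "(F has_real_derivative \<Phi> x) (at x within {-pi..pi})" if "x \<in> {-pi..pi}" for x
    unfolding F_def \<Phi>_def by (rule double_integral_DERIV[OF fi that])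
  have \<Phi>c: "continuous_on {-pi..pi} \<Phi>"
    unfolding \<Phi>_def by (rule indefinite_integral_continuous_1[OF fi])
  have Wc: "continuous_on {-pi..pi} W"
    unfolding W_def by (intro continuous_intros Fc continuous_point_kernel)
  have W_ends: "W pi = 0" "W (- pi) = 0"
    using b by (simp_all add: W_def point_kernel_endpoints k0_def F_def double_integral_def)
  have w_W: "AE x in lebesgue_on II. w x = W x"
    using rep unfolding W_def II_def .

  have e''D: "(e' has_real_derivative W x) (at x within {-pi..pi})" if "x \<in> {-pi..pi}" for x
  proof (rule weak_second_deriv_imp_classical[OF _ e'c Wc e'D_int _ that])
    fix \<phi> assume \<phi>: "\<phi> \<in> test_functions {-pi<..<pi}"
    have s: "smooth \<phi>" using \<phi> by (rule test_functions_smooth)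
    have c: "continuous_on {-pi..pi} \<phi>" "continuous_on {-pi..pi} (deriv (deriv \<phi>))"
      using s by (auto intro: smooth_continuous_on smooth_deriv)
    have \<phi>m: "\<phi> \<in> borel_measurable (lebesgue_on II)" "W \<in> borel_measurable (lebesgue_on II)"
      using c(1)[THEN continuous_in_L2_on] Wc[THEN continuous_in_L2_on] by (auto simp: L2_on_def II_def)
    have "integral {-pi..pi} (\<lambda>x. e x * deriv (deriv \<phi>) x) = (LINT x|lebesgue_on II. e x * (deriv ^^ 2) \<phi> x)"
      unfolding II_def numeral_2_eq_2
      by (simp add: LINT_Ioo_eq_integral absolutely_integrable_continuous_real continuous_on_mult e'c c)
    also have "\<dots> = (LINT x|lebesgue_on II. w x * \<phi> x)"
      using w \<phi> by (simp add: has_weak_deriv_def II_def)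
    also have "\<dots> = (LINT x|lebesgue_on II. W x * \<phi> x)"
    proof (rule integral_cong_AE)
      show "AE x in lebesgue_on II. w x * \<phi> x = W x * \<phi> x"
        by (rule lebesgue_on_mono[OF w_W]) simp
    qed (intro borel_measurable_times w_meas \<phi>m)+
    also have "\<dots> = integral {-pi..pi} (\<lambda>x. W x * \<phi> x)"
      unfolding II_def
      by (intro LINT_Ioo_eq_integral absolutely_integrable_continuous_real continuous_on_mult Wc c)
    finally show "integral {-pi..pi} (\<lambda>x. e x * deriv (deriv \<phi>) x) = integral {-pi..pi} (\<lambda>x. W x * \<phi> x)" .
  qed simp_all

  define D where "D j = (if j = 0 then e else if j = 1 then e' else W)" for j :: nat
  have D: "(D j has_real_derivative D (Suc j) x) (at x within {-pi..pi})" if "j < 2" "x \<in> {-pi..pi}" for j x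
  proof -
    have "j = 0 \<or> j = 1" using that by auto
    then show ?thesis using that e'D e''D by (auto simp: D_def)
  qed
  have C2: "e \<in> C_on 2 (closure II)"
    unfolding closure_II by (rule C_on_IccI[of _ _ _ D]) (use D Wc in \<open>auto simp: D_def\<close>)
  have "deriv_within {-pi..pi} 2 e x = D 2 x" if "x \<in> {-pi..pi}" for x
    by (rule deriv_within_Icc[of "-pi" pi e D 2]) (use D that in \<open>auto simp: D_def\<close>)
  then have e''_ends: "deriv_within (closure II) 2 e pi = 0" "deriv_within (closure II) 2 e (- pi) = 0"
    using W_ends by (auto simp: closure_II D_def)

  \<comment> \<open>On a piece that contains neither \<open>b\<close> nor \<open>-b\<close> in its interior both absolute values are affine,
    with signs \<open>\<sigma>\<close> and \<open>\<tau>\<close>; this is where the kinks of \<open>W\<close> are confined to \<open>\<plusminus>b\<close>.\<close>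
  have piece: "e \<in> C_on 3 {s..t}"
    "\<And>x y. x \<in> {s<..<t} \<Longrightarrow> (\<Phi> has_real_derivative y) (at x) \<Longrightarrow> ((deriv ^^ 3) e has_real_derivative y) (at x)"
    if st: "- pi \<le> s" "s < t" "t \<le> pi"
      and affine: "\<And>x. x \<in> {s..t} \<Longrightarrow> \<bar>x - b\<bar> = \<sigma> * (x - b)" "\<And>x. x \<in> {s..t} \<Longrightarrow> \<bar>x + b\<bar> = \<tau> * (x + b)"
    for s t \<sigma> \<tau>
  proof -
    define m where "m = - k0 + c1 * (\<sigma> + b / pi) / 2 + c2 * (\<tau> - b / pi) / 2"
    define q where "q = - k0 * pi - c1 * (\<sigma> * b + pi) / 2 + c2 * (\<tau> * b - pi) / 2"
    have "W x = F x + m * x + q" if "x \<in> {s..t}" for x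
    proof -
      have "\<bar>x - - b\<bar> = \<tau> * (x + b)" using affine(2)[OF that] by simp
      then show ?thesis
        by (simp only: W_def point_kernel_def affine(1)[OF that] m_def q_def) (simp add: field_simps)
    qed
    note third_derivative_on_piece[OF st e'D e''D FD \<Phi>c this]
    then show "e \<in> C_on 3 {s..t}"
      "\<And>x y. x \<in> {s<..<t} \<Longrightarrow> (\<Phi> has_real_derivative y) (at x) \<Longrightarrow> ((deriv ^^ 3) e has_real_derivative y) (at x)"
      by blast+
  qed
  have minus: "e \<in> C_on 3 {-pi..-b}"
    "\<And>x y. x \<in> {-pi<..<-b} \<Longrightarrow> (\<Phi> has_real_derivative y) (at x) \<Longrightarrow> ((deriv ^^ 3) e has_real_derivative y) (at x)"
    using b by (auto intro!: piece[of "-pi" "-b" "-1" "-1"])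
  have zero: "e \<in> C_on 3 {-b..b}"
    "\<And>x y. x \<in> {-b<..<b} \<Longrightarrow> (\<Phi> has_real_derivative y) (at x) \<Longrightarrow> ((deriv ^^ 3) e has_real_derivative y) (at x)"
    using b by (auto intro!: piece[of "-b" b "-1" 1])
  have plus: "e \<in> C_on 3 {b..pi}"
    "\<And>x y. x \<in> {b<..<pi} \<Longrightarrow> (\<Phi> has_real_derivative y) (at x) \<Longrightarrow> ((deriv ^^ 3) e has_real_derivative y) (at x)"
    using b by (auto intro!: piece[of b pi 1 1])

  have "AE x in lebesgue_on II. (\<Phi> has_real_derivative f x) (at x)"
    using AE_has_derivative_indefinite_integral[OF fi] unfolding II_def \<Phi>_def[abs_def] .
  moreover have "AE x in lebesgue_on II. x \<noteq> b \<and> x \<noteq> - b"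
  proof -
    have "negligible {x \<in> II. \<not> (x \<noteq> b \<and> x \<noteq> - b)}"
      by (rule negligible_subset[of "{b, - b}"]) auto
    then show ?thesis using II(2) by (simp only: AE_lebesgue_on_iff_negligible)
  qed
  ultimately have "AE x in lebesgue_on II. (\<Phi> has_real_derivative lam * p x * e x) (at x) \<and> x \<noteq> b \<and> x \<noteq> - b"
    using f_AE by eventually_elim simp
  then have classical: "AE x in lebesgue_on II. (deriv ^^ 3) e differentiable (at x) \<and> (deriv ^^ 4) e x = lam * p x * e x"
  proof (rule lebesgue_on_mono)
    fix x assume x: "(\<Phi> has_real_derivative lam * p x * e x) (at x) \<and> x \<noteq> b \<and> x \<noteq> - b" "x \<in> II"
    then have "x \<in> {-pi<..<-b} \<or> x \<in> {-b<..<b} \<or> x \<in> {b<..<pi}"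
      by (auto simp: II_def)
    then have d: "((deriv ^^ 3) e has_real_derivative lam * p x * e x) (at x)"
      using x minus(2) zero(2) plus(2) by blast
    moreover have "(deriv ^^ 4) e = deriv ((deriv ^^ 3) e)"
      by (simp add: eval_nat_numeral)
    ultimately show "(deriv ^^ 3) e differentiable (at x) \<and> (deriv ^^ 4) e x = lam * p x * e x"
      using DERIV_imp_deriv real_differentiable_def by metis
  qed

  define U where "U = I_minus a \<union> I_zero a \<union> I_plus a"
  have U: "U \<subseteq> II" "open U" "b \<notin> U" "- b \<notin> U"
    using b by (auto simp: U_def I_minus_def I_zero_def I_plus_def II_def ab intro!: open_Un)
  have weak4: "has_weak_deriv U 4 e (\<lambda>x. lam * p x * e x)"
    unfolding has_weak_deriv_def
  proof (intro conjI ballI)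
    show "e \<in> L1_loc_on U"
      using U(1) by (intro continuous_in_L1_loc continuous_on_subset[OF e'c(1)]) (auto simp: II_def)
    have g_int: "integrable (lebesgue_on II) (\<lambda>x. lam * p x * e x)"
      using \<open>integrable (lebesgue_on II) f\<close> integrable_cong_AE[OF f_meas g_meas f_AE] by simp
    show "(\<lambda>x. lam * p x * e x) \<in> L1_loc_on U"
      unfolding L1_loc_on_def
    proof (intro CollectI allI impI)
      fix K assume K: "compact K \<and> K \<subseteq> U"
      then have "K \<in> sets lebesgue" using lmeasurable_compact by blast
      moreover have "K \<subseteq> II" using K U(1) by blast
      ultimately show "integrable (lebesgue_on K) (\<lambda>x. lam * p x * e x)"
        using g_int II(2) set_integrable_subset[of lebesgue II "\<lambda>x. lam * p x * e x" K]
        by (simp add: integrable_lebesgue_on_iff_absolutely_integrable)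
    qed
    fix \<phi> assume \<phi>: "\<phi> \<in> test_functions U"
    have \<phi>II: "\<phi> \<in> test_functions II" "deriv (deriv \<phi>) \<in> test_functions II"
      using \<phi> test_functions_mono[OF U(1)] by (auto intro: deriv_test_function)
    have s: "smooth \<phi>" using \<phi> by (rule test_functions_smooth)
    have "\<phi> pi = 0" "\<phi> (- pi) = 0" "\<phi> b = 0" "\<phi> (- b) = 0"
      using test_function_outside[OF \<phi>] test_function_outside[OF \<phi>II(1)] U(3,4) by (auto simp: II_def)
    then have \<phi>V: "\<phi> \<in> V_space a"
      using ab by (intro smooth_in_V_space s) auto
    have supp: "(LINT x|lebesgue_on U. g x * \<psi> x) = (LINT x|lebesgue_on II. g x * \<psi> x)"
      if "\<psi> \<in> test_functions U" for g \<psi>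
      using U that test_function_outside[OF that]
      by (intro lebesgue_on_supported_in(2)[symmetric] II) auto
    \<comment> \<open>Both sides are compared through \<open>w\<close>: the test function \<open>\<phi>''\<close> enters the definition of the
      weak second derivative, and \<open>\<phi>\<close> itself the weak equation.\<close>
    have d4: "(deriv ^^ 4) \<phi> = (deriv ^^ 2) (deriv (deriv \<phi>))"
      by (simp add: eval_nat_numeral)
    have "(LINT x|lebesgue_on U. e x * (deriv ^^ 4) \<phi> x) = (LINT x|lebesgue_on II. e x * (deriv ^^ 2) (deriv (deriv \<phi>)) x)"
      unfolding d4[symmetric] by (rule supp[OF funpow_deriv_test_function[OF \<phi>]])
    also have "\<dots> = (LINT x|lebesgue_on II. w x * deriv (deriv \<phi>) x)"
      using w \<phi>II(2) by (simp add: has_weak_deriv_def)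
    also have "\<dots> = integral {-pi..pi} (\<lambda>x. w x * deriv (deriv \<phi>) x)"
      using continuous_times_absolutely_integrable[OF smooth_continuous_on[OF smooth_deriv[OF smooth_deriv[OF s]]] w_int]
      unfolding II_def by (intro LINT_Ioo_eq_integral) (simp add: mult.commute)
    also have "\<dots> = lam * (LINT x|lebesgue_on II. p x * e x * \<phi> x)"
      by (rule weak_eq(1)[OF s \<phi>V])
    also have "\<dots> = (LINT x|lebesgue_on II. lam * p x * e x * \<phi> x)"
      by (simp add: mult.assoc)
    also have "\<dots> = (LINT x|lebesgue_on U. lam * p x * e x * \<phi> x)"
      by (rule supp[OF \<phi>, symmetric])
    finally show "(LINT x|lebesgue_on U. e x * (deriv ^^ 4) \<phi> x) = (- 1) ^ 4 * (LINT x|lebesgue_on U. lam * p x * e x * \<phi> x)"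
      by simp
  qed

  show ?thesis
    using weak4 classical e_ends e''_ends e(4,5) C2 minus(1) zero(1) plus(1) b
    by (simp add: solves_ode_ae_def U_def I_minus_def I_zero_def I_plus_def ab)
qed

end
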